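(* Let $p$ be an odd prime and let $\alpha\in\mathbb{Q}_p$ have a periodic Browkin II expansion $$\alpha=[b_0,b_1,\ldots,b_{h-1},\overline{b_h,\ldots,b_{h+k-1}}].$$ If $$|\alpha|_p=1,\qquad |\overline{\alpha}|_p<1,$$ where $\overline{\alpha}$ is the conjugate of $\alpha$, then the preperiod length of the expansion cannot be odd.
   Context: Let $p$ be an odd prime, and let $v_p$, $|\cdot|_p$ be the $p$-adic valuation and norm on $\mathbb{Q}_p$. Every $\alpha\in\mathbb{Q}_p$ is written uniquely as $\alpha=\sum_{n=-r}^{+\infty}a_np^n$ with $r\in\mathbb{Z}$ and digits $a_n\in\{-\frac{p-1}{2},\ldots,\frac{p-1}{2}\}$. Define $s(\alpha)=\sum_{n=-r}^{0}a_np^n\in\mathbb{Q}$ and $t(\alpha)=\sum_{n=-r}^{-1}a_np^n\in\mathbb{Q}$ (empty sums are $0$), and let $\mathrm{sign}$ be the usual sign function on $\mathbb{Q}$. The algorithm Browkin II, started at $\alpha_0=\alpha\in\mathbb{Q}_p$, computes for $n\ge 0$: $b_n=s(\alpha_n)$ if $n$ is even; $b_n=t(\alpha_n)$ if $n$ is odd and $v_p(\alpha_n-t(\alpha_n))=0$; $b_n=t(\alpha_n)-\mathrm{sign}(t(\alpha_n))$ if $n$ is odd and $v_p(\alpha_n-t(\alpha_n))\neq 0$; and $\alpha_{n+1}=\frac{1}{\alpha_n-b_n}$ (stopping if $\alpha_n=b_n$). The sequence $[b_0,b_1,\ldots]$ is the Browkin II expansion of $\alpha$. An infinite expansion is periodic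 if there are $h\ge 0$ and $k\ge 1$ with $b_{n+k}=b_n$ for all $n\ge h$, written $[b_0,\ldots,b_{h-1},\overline{b_h,\ldots,b_{h+k-1}}]$. The preperiod length is the smallest $h\geq 0$ for which such a $k$ exists. If $\alpha\in\mathbb{Q}_p$ has a periodic expansion, it is a root of an irreducible polynomial of degree $2$ over $\mathbb{Q}$; its conjugate $\overline{\alpha}\in\mathbb{Q}_p$ is the other root of this polynomial. *)

theory Defs
  imports
    "HOL-Library.Extended_Real"
    "HOL-Computational_Algebra.Polynomial_Factorial"
    "Berlekamp_Zassenhaus.Finite_Field"
begin

section \<open>The \<open>p\<close>-adic absolute value on the rationals\<close>

definition rat_pval :: "nat \<Rightarrow> rat \<Rightarrow> int" where
  "rat_pval p x = (case quotient_of x of (a, b) \<Rightarrow>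
     int (multiplicity (int p) a) - int (multiplicity (int p) b))"

definition rat_pnorm :: "nat \<Rightarrow> rat \<Rightarrow> real" where
  "rat_pnorm p x = (if x = 0 then 0 else real p powi (- rat_pval p x))"

lemma rat_pval_divide:
  assumes p: "prime p" and "a \<noteq> 0" "b \<noteq> 0"
  shows "rat_pval p (of_int a / of_int b) =
    int (multiplicity (int p) a) - int (multiplicity (int p) b)"
proof -
  have pe: "prime_elem (int p)" using p by auto
  obtain c d where cd: "quotient_of (of_int a / of_int b) = (c, d)" by force
  then have d: "d > 0" using quotient_of_denom_pos by blast
  have "of_int a / of_int b = (of_int c / of_int d :: rat)"
    using quotient_of_div[OF cd] .
  then have "of_int (a * d) = (of_int (c * b) :: rat)"
    using d assms by (simp add: field_simps)
  then have eq: "a * d = c * b" using of_int_eq_iff by blast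
  then have c: "c \<noteq> 0" using d assms by auto
  have "multiplicity (int p) a + multiplicity (int p) d =
      multiplicity (int p) c + multiplicity (int p) b"
    using prime_elem_multiplicity_mult_distrib[OF pe] eq c d assms
    by (metis less_irrefl)
  then show ?thesis unfolding rat_pval_def cd by simp
qed

lemma rat_as_quotient:
  obtains a b :: int where "x = (of_int a / of_int b :: rat)" "b \<noteq> 0"
proof -
  obtain a b where q: "quotient_of x = (a, b)" by force
  then have "b > 0" by (rule quotient_of_denom_pos)
  then show ?thesis using that[of a b] quotient_of_div[OF q] by simp
qed

lemma rat_pnorm_nonneg [simp]: "rat_pnorm p x \<ge> 0"
  by (simp add: rat_pnorm_def)

lemma rat_pnorm_0 [simp]: "rat_pnorm p 0 = 0"
  by (simp add: rat_pnorm_def)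

lemma rat_pnorm_eq_0_iff [simp]: "prime p \<Longrightarrow> rat_pnorm p x = 0 \<longleftrightarrow> x = 0"
  by (auto simp: rat_pnorm_def)

lemma rat_pval_mult:
  assumes "prime p" "x \<noteq> 0" "y \<noteq> 0"
  shows "rat_pval p (x * y) = rat_pval p x + rat_pval p y"
proof -
  have pe: "prime_elem (int p)" using assms by auto
  obtain a b where x: "x = of_int a / of_int b" "b \<noteq> 0" by (rule rat_as_quotient)
  obtain c d where y: "y = of_int c / of_int d" "d \<noteq> 0" by (rule rat_as_quotient)
  have nz: "a \<noteq> 0" "c \<noteq> 0" using assms x y by auto
  have "x * y = of_int (a * c) / of_int (b * d)" using x y by simp
  then have "rat_pval p (x * y) =
      int (multiplicity (int p) (a * c)) - int (multiplicity (int p) (b * d))"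
    using rat_pval_divide[OF assms(1), of "a * c" "b * d"] x y nz by simp
  then show ?thesis
    using rat_pval_divide[OF assms(1), of a b] rat_pval_divide[OF assms(1), of c d] x y nz
    by (simp add: prime_elem_multiplicity_mult_distrib[OF pe])
qed

lemma rat_pnorm_mult:
  assumes "prime p"
  shows "rat_pnorm p (x * y) = rat_pnorm p x * rat_pnorm p y"
proof (cases "x = 0 \<or> y = 0")
  case False
  have "real p \<noteq> 0" using assms by auto
  then show ?thesis using False assms
    by (simp add: rat_pnorm_def rat_pval_mult power_int_diff power_int_minus field_simps power_int_add)
qed (auto simp: rat_pnorm_def)

lemma rat_pnorm_1 [simp]: "rat_pnorm p 1 = 1"
  by (simp add: rat_pnorm_def rat_pval_def)

lemma rat_pnorm_minus [simp]:
  assumes "prime p" shows "rat_pnorm p (- x) = rat_pnorm p x"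
proof -
  have "rat_pnorm p (-1) * rat_pnorm p (-1) = 1"
    by (simp flip: rat_pnorm_mult[OF assms])
  then have "rat_pnorm p (-1) = 1"
    by (metis rat_pnorm_nonneg abs_of_nonneg mult_minus_left real_sqrt_abs2 real_sqrt_one)
  then show ?thesis using rat_pnorm_mult[OF assms, of "-1" x] by simp
qed

lemma rat_pnorm_add:
  assumes p: "prime p"
  shows "rat_pnorm p (x + y) \<le> max (rat_pnorm p x) (rat_pnorm p y)"
proof (cases "x = 0 \<or> y = 0 \<or> x + y = 0")
  case True
  then show ?thesis using rat_pnorm_nonneg[of p x] by (auto simp: le_max_iff_disj simp del: rat_pnorm_nonneg)
next
  case False
  obtain a b where x: "x = of_int a / of_int b" "b \<noteq> 0" by (rule rat_as_quotient)
  obtain c d where y: "y = of_int c / of_int d" "d \<noteq> 0" by (rule rat_as_quotient)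
  have x': "x = of_int (a * d) / of_int (b * d)" and y': "y = of_int (c * b) / of_int (b * d)"
    and s: "x + y = of_int (a * d + c * b) / of_int (b * d)"
    using x y by (auto simp: field_simps)
  have bd: "b * d \<noteq> 0" using x y by simp
  have nz: "a * d \<noteq> 0" "c * b \<noteq> 0" "a * d + c * b \<noteq> 0"
    using False x' y' s by (metis div_0 of_int_0)+
  define m where "m = min (multiplicity (int p) (a * d)) (multiplicity (int p) (c * b))"
  have "int p ^ m dvd a * d + c * b"
    by (intro dvd_add multiplicity_dvd') (auto simp: m_def)
  then have m: "m \<le> multiplicity (int p) (a * d + c * b)"
    using nz(3) p by (intro multiplicity_geI) auto
  note v = rat_pval_divide[OF p nz(1) bd, folded x'] rat_pval_divide[OF p nz(2) bd, folded y']
    rat_pval_divide[OF p nz(3) bd, folded s]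
  have "rat_pval p x \<le> rat_pval p (x + y) \<or> rat_pval p y \<le> rat_pval p (x + y)"
    using m unfolding v m_def by linarith
  moreover have "1 \<le> real p" using p prime_ge_1_nat by simp
  ultimately show ?thesis using False
    by (auto simp: rat_pnorm_def le_max_iff_disj intro!: power_int_increasing)
qed

lemma rat_pnorm_diff:
  assumes p: "prime p"
  shows "rat_pnorm p (x - y) \<le> max (rat_pnorm p x) (rat_pnorm p y)"
  using rat_pnorm_add[OF p, of x "-y"] p by simp

lemma rat_pnorm_diff_commute:
  assumes p: "prime p"
  shows "rat_pnorm p (x - y) = rat_pnorm p (y - x)"
  using rat_pnorm_minus[OF p, of "x - y"] by simp

lemma rat_pnorm_abs_diff:
  assumes p: "prime p"
  shows "\<bar>rat_pnorm p x - rat_pnorm p y\<bar> \<le> rat_pnorm p (x - y)"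
proof -
  have "rat_pnorm p x \<le> max (rat_pnorm p (x - y)) (rat_pnorm p y)"
    "rat_pnorm p y \<le> max (rat_pnorm p (x - y)) (rat_pnorm p x)"
    using rat_pnorm_add[OF p, of "x - y" y] rat_pnorm_add[OF p, of "y - x" x]
      rat_pnorm_diff_commute[OF p, of x y] by simp_all
  moreover have "0 \<le> rat_pnorm p x" "0 \<le> rat_pnorm p y" "0 \<le> rat_pnorm p (x - y)" by simp_all
  ultimately show ?thesis by linarith
qed

lemma rat_pnorm_inverse:
  assumes p: "prime p"
  shows "rat_pnorm p (inverse x) = inverse (rat_pnorm p x)"
proof (cases "x = 0")
  case False
  then show ?thesis using rat_pnorm_mult[OF p, of x "inverse x"] p
    by (simp add: inverse_eq_divide field_simps)
qed auto


section \<open>\<open>p\<close>-adic Cauchy sequences of rationals\<close>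

definition padic_Cauchy :: "nat \<Rightarrow> (nat \<Rightarrow> rat) \<Rightarrow> bool" where
  "padic_Cauchy p X \<longleftrightarrow> (\<forall>e>0. \<exists>N. \<forall>m\<ge>N. \<forall>n\<ge>N. rat_pnorm p (X m - X n) < e)"

definition padic_null :: "nat \<Rightarrow> (nat \<Rightarrow> rat) \<Rightarrow> bool" where
  "padic_null p X \<longleftrightarrow> (\<lambda>n. rat_pnorm p (X n)) \<longlonglongrightarrow> 0"

lemma padic_Cauchy_const [simp]: "padic_Cauchy p (\<lambda>n. c)"
  by (simp add: padic_Cauchy_def)

lemma padic_null_0 [simp]: "padic_null p (\<lambda>n. 0)"
  by (simp add: padic_null_def)

lemma padic_Cauchy_minus:
  assumes p: "prime p" and X: "padic_Cauchy p X"
  shows "padic_Cauchy p (\<lambda>n. - X n)"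
  using X rat_pnorm_diff_commute[OF p] by (simp add: padic_Cauchy_def)

lemma padic_Cauchy_add:
  assumes p: "prime p" and X: "padic_Cauchy p X" and Y: "padic_Cauchy p Y"
  shows "padic_Cauchy p (\<lambda>n. X n + Y n)"
  unfolding padic_Cauchy_def
proof (intro allI impI)
  fix e :: real assume e: "e > 0"
  obtain M where M: "\<forall>m\<ge>M. \<forall>n\<ge>M. rat_pnorm p (X m - X n) < e"
    using X e unfolding padic_Cauchy_def by blast
  obtain N where N: "\<forall>m\<ge>N. \<forall>n\<ge>N. rat_pnorm p (Y m - Y n) < e"
    using Y e unfolding padic_Cauchy_def by blast
  have "rat_pnorm p (X m + Y m - (X n + Y n)) < e" if "m \<ge> max M N" "n \<ge> max M N" for m n
    unfolding add_diff_add
    by (rule le_less_trans[OF rat_pnorm_add[OF p]]) (use M N that in auto)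
  then show "\<exists>N. \<forall>m\<ge>N. \<forall>n\<ge>N. rat_pnorm p (X m + Y m - (X n + Y n)) < e" by blast
qed

lemma padic_Cauchy_norm_convergent:
  assumes p: "prime p" and X: "padic_Cauchy p X"
  shows "convergent (\<lambda>n. rat_pnorm p (X n))"
proof -
  have "Cauchy (\<lambda>n. rat_pnorm p (X n))"
    unfolding Cauchy_def dist_real_def
    using X rat_pnorm_abs_diff[OF p] unfolding padic_Cauchy_def
    by (meson le_less_trans)
  then show ?thesis by (rule Cauchy_convergent)
qed

lemma padic_Cauchy_bounded:
  assumes p: "prime p" and X: "padic_Cauchy p X"
  obtains B where "B > 0" "\<And>n. rat_pnorm p (X n) \<le> B"
proof -
  have "Bseq (\<lambda>n. rat_pnorm p (X n))"
    using padic_Cauchy_norm_convergent[OF assms] by (rule convergent_imp_Bseq)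
  then show ?thesis using that by (auto simp: Bseq_def)
qed

lemma padic_Cauchy_mult:
  assumes p: "prime p" and X: "padic_Cauchy p X" and Y: "padic_Cauchy p Y"
  shows "padic_Cauchy p (\<lambda>n. X n * Y n)"
  unfolding padic_Cauchy_def
proof (intro allI impI)
  fix e :: real assume e: "e > 0"
  obtain A where A: "A > 0" "\<And>n. rat_pnorm p (X n) \<le> A"
    using padic_Cauchy_bounded[OF p X] by blast
  obtain B where B: "B > 0" "\<And>n. rat_pnorm p (Y n) \<le> B"
    using padic_Cauchy_bounded[OF p Y] by blast
  obtain M where M: "\<forall>m\<ge>M. \<forall>n\<ge>M. rat_pnorm p (X m - X n) < e / B"
    using X e B unfolding padic_Cauchy_def by (meson divide_pos_pos)
  obtain N where N: "\<forall>m\<ge>N. \<forall>n\<ge>N. rat_pnorm p (Y m - Y n) < e / A"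
    using Y e A unfolding padic_Cauchy_def by (meson divide_pos_pos)
  have "rat_pnorm p (X m * Y m - X n * Y n) < e" if "m \<ge> max M N" "n \<ge> max M N" for m n
  proof -
    have "X m * Y m - X n * Y n = X m * (Y m - Y n) + (X m - X n) * Y n"
      by (simp add: algebra_simps)
    then have "rat_pnorm p (X m * Y m - X n * Y n) \<le>
        max (rat_pnorm p (X m) * rat_pnorm p (Y m - Y n)) (rat_pnorm p (X m - X n) * rat_pnorm p (Y n))"
      using rat_pnorm_add[OF p] by (simp add: rat_pnorm_mult[OF p, symmetric])
    moreover have "rat_pnorm p (X m) * rat_pnorm p (Y m - Y n) \<le> A * rat_pnorm p (Y m - Y n)"
      using A by (intro mult_right_mono) auto
    moreover have "A * rat_pnorm p (Y m - Y n) < e"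
      using N that A by (auto simp: field_simps)
    moreover have "rat_pnorm p (X m - X n) * rat_pnorm p (Y n) \<le> rat_pnorm p (X m - X n) * B"
      using B by (intro mult_left_mono) auto
    moreover have "rat_pnorm p (X m - X n) * B < e"
      using M that B by (auto simp: field_simps)
    ultimately show ?thesis by linarith
  qed
  then show "\<exists>N. \<forall>m\<ge>N. \<forall>n\<ge>N. rat_pnorm p (X m * Y m - X n * Y n) < e" by blast
qed

lemma padic_null_comparison:
  assumes "(f \<longlonglongrightarrow> 0)" "\<And>n. rat_pnorm p (X n) \<le> f n"
  shows "padic_null p X"
  unfolding padic_null_def
  by (rule tendsto_sandwich[of "\<lambda>_. 0" _ _ f]) (use assms in auto)

lemma padic_null_minus:
  "prime p \<Longrightarrow> padic_null p X \<Longrightarrow> padic_null p (\<lambda>n. - X n)"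
  by (simp add: padic_null_def)

lemma padic_null_add:
  assumes p: "prime p" and X: "padic_null p X" and Y: "padic_null p Y"
  shows "padic_null p (\<lambda>n. X n + Y n)"
proof (rule padic_null_comparison)
  show "(\<lambda>n. max (rat_pnorm p (X n)) (rat_pnorm p (Y n))) \<longlonglongrightarrow> 0"
    using tendsto_max[OF X[unfolded padic_null_def] Y[unfolded padic_null_def]] by simp
qed (rule rat_pnorm_add[OF p])

lemma padic_null_mult:
  assumes p: "prime p" and X: "padic_Cauchy p X" and Y: "padic_null p Y"
  shows "padic_null p (\<lambda>n. X n * Y n)"
proof -
  obtain A where A: "A > 0" "\<And>n. rat_pnorm p (X n) \<le> A"
    using padic_Cauchy_bounded[OF p X] by blast
  show ?thesis
  proof (rule padic_null_comparison)
    show "(\<lambda>n. A * rat_pnorm p (Y n)) \<longlonglongrightarrow> 0"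
      using tendsto_mult_right_zero[OF Y[unfolded padic_null_def]] .
    show "rat_pnorm p (X n * Y n) \<le> A * rat_pnorm p (Y n)" for n
      unfolding rat_pnorm_mult[OF p] using A by (intro mult_right_mono) auto
  qed
qed

lemma padic_not_null_bound:
  assumes p: "prime p" and X: "padic_Cauchy p X" and nz: "\<not> padic_null p X"
  obtains c N where "c > 0" "\<And>n. n \<ge> N \<Longrightarrow> rat_pnorm p (X n) > c"
proof -
  obtain L where L: "(\<lambda>n. rat_pnorm p (X n)) \<longlonglongrightarrow> L"
    using padic_Cauchy_norm_convergent[OF p X] by (auto simp: convergent_def)
  have "L \<ge> 0" using L by (rule LIMSEQ_le_const) auto
  moreover have "L \<noteq> 0" using nz L by (auto simp: padic_null_def)
  ultimately have "L / 2 < L" "L / 2 > 0" by auto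
  moreover from order_tendstoD(1)[OF L this(1)] obtain N where
    "\<And>n. n \<ge> N \<Longrightarrow> rat_pnorm p (X n) > L / 2"
    by (auto simp: eventually_sequentially)
  ultimately show ?thesis using that by blast
qed

lemma padic_Cauchy_inverse:
  assumes p: "prime p" and X: "padic_Cauchy p X" and nz: "\<not> padic_null p X"
  shows "padic_Cauchy p (\<lambda>n. inverse (X n))"
  unfolding padic_Cauchy_def
proof (intro allI impI)
  fix e :: real assume e: "e > 0"
  obtain c M where c: "c > 0" and M: "\<And>n. n \<ge> M \<Longrightarrow> rat_pnorm p (X n) > c"
    using padic_not_null_bound[OF assms] by blast
  obtain N where N: "\<forall>m\<ge>N. \<forall>n\<ge>N. rat_pnorm p (X m - X n) < e * (c * c)"
    using X e c unfolding padic_Cauchy_def by (meson mult_pos_pos)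
  have "rat_pnorm p (inverse (X m) - inverse (X n)) < e" if mn: "m \<ge> max M N" "n \<ge> max M N" for m n
  proof -
    have gt: "rat_pnorm p (X m) > c" "rat_pnorm p (X n) > c" using M mn by auto
    then have nz: "X m \<noteq> 0" "X n \<noteq> 0" using c by (auto simp: rat_pnorm_def)
    have "inverse (X m) - inverse (X n) = (X n - X m) * (inverse (X m) * inverse (X n))"
      using nz by (simp add: field_simps)
    then have "rat_pnorm p (inverse (X m) - inverse (X n)) =
        rat_pnorm p (X n - X m) / (rat_pnorm p (X m) * rat_pnorm p (X n))"
      by (simp only: rat_pnorm_mult[OF p] rat_pnorm_inverse[OF p] divide_inverse inverse_mult_distrib)
    also have "\<dots> \<le> rat_pnorm p (X n - X m) / (c * c)"
      using gt c by (intro divide_left_mono mult_mono mult_pos_pos) auto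
    also have "\<dots> < e" using N mn c by (simp add: field_simps)
    finally show ?thesis .
  qed
  then show "\<exists>N. \<forall>m\<ge>N. \<forall>n\<ge>N. rat_pnorm p (inverse (X m) - inverse (X n)) < e" by blast
qed

lemma padic_null_diff_imp:
  assumes p: "prime p" and XY: "padic_null p (\<lambda>n. X n - Y n)" and Y: "padic_null p Y"
  shows "padic_null p X"
  using padic_null_add[OF p XY Y] by simp

lemma padic_null_mult_inverse:
  assumes p: "prime p" and X: "padic_Cauchy p X" and nz: "\<not> padic_null p X"
  shows "padic_null p (\<lambda>n. inverse (X n) * X n - 1)"
proof -
  obtain c M where c: "c > 0" and M: "\<And>n. n \<ge> M \<Longrightarrow> rat_pnorm p (X n) > c"
    using padic_not_null_bound[OF assms] by blast
  then have "X n \<noteq> 0" if "n \<ge> M" for n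
    using that c by (force simp: rat_pnorm_def)
  then have "\<forall>\<^sub>F n in sequentially. rat_pnorm p (inverse (X n) * X n - 1) = 0"
    unfolding eventually_sequentially by (intro exI[of _ M]) auto
  then show ?thesis unfolding padic_null_def by (rule tendsto_eventually)
qed

lemma padic_norm_lim_eq:
  assumes p: "prime p" and X: "padic_Cauchy p X"
    and XY: "padic_null p (\<lambda>n. X n - Y n)"
  shows "lim (\<lambda>n. rat_pnorm p (X n)) = lim (\<lambda>n. rat_pnorm p (Y n))"
proof -
  obtain L where L: "(\<lambda>n. rat_pnorm p (X n)) \<longlonglongrightarrow> L"
    using padic_Cauchy_norm_convergent[OF p X] by (auto simp: convergent_def)
  have "(\<lambda>n. rat_pnorm p (X n) - rat_pnorm p (Y n)) \<longlonglongrightarrow> 0"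
    by (rule tendsto_rabs_zero_cancel, rule tendsto_sandwich[of "\<lambda>_. 0"])
      (use XY[unfolded padic_null_def] rat_pnorm_abs_diff[OF p] in auto)
  from tendsto_diff[OF L this] have "(\<lambda>n. rat_pnorm p (Y n)) \<longlonglongrightarrow> L" by simp
  then show ?thesis using L by (simp add: limI)
qed


section \<open>The field of \<open>p\<close>-adic numbers\<close>

text \<open>
  The prime \<open>p\<close> is the cardinality of the index type \<open>'p\<close>, and \<open>'p padic\<close> is
  the completion of the rationals with respect to the \<open>p\<close>-adic absolute value, that is,
  Cauchy sequences modulo null sequences.
\<close>

typedef (overloaded) 'p padic_seq = "{X. padic_Cauchy CARD('p::prime_card) X}"
  by (rule exI[of _ "\<lambda>_. 0"]) simp

setup_lifting type_definition_padic_seq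

lift_definition padic_seq_rel :: "'p::prime_card padic_seq \<Rightarrow> 'p padic_seq \<Rightarrow> bool"
  is "\<lambda>X Y. padic_null CARD('p) (\<lambda>n. X n - Y n)" .

instantiation padic_seq :: (prime_card) comm_ring_1
begin
lift_definition zero_padic_seq :: "'a padic_seq" is "\<lambda>_. 0" by simp
lift_definition one_padic_seq :: "'a padic_seq" is "\<lambda>_. 1" by simp
lift_definition plus_padic_seq :: "'a padic_seq \<Rightarrow> 'a padic_seq \<Rightarrow> 'a padic_seq"
  is "\<lambda>X Y n. X n + Y n" by (rule padic_Cauchy_add[OF prime_card])
lift_definition times_padic_seq :: "'a padic_seq \<Rightarrow> 'a padic_seq \<Rightarrow> 'a padic_seq"
  is "\<lambda>X Y n. X n * Y n" by (rule padic_Cauchy_mult[OF prime_card])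
lift_definition uminus_padic_seq :: "'a padic_seq \<Rightarrow> 'a padic_seq"
  is "\<lambda>X n. - X n" by (rule padic_Cauchy_minus[OF prime_card])
definition minus_padic_seq :: "'a padic_seq \<Rightarrow> 'a padic_seq \<Rightarrow> 'a padic_seq"
  where "minus_padic_seq x y = x + - y"
instance
  by standard (unfold minus_padic_seq_def, (transfer; simp add: algebra_simps fun_eq_iff)+)
end

lift_definition padic_seq_inverse :: "'p::prime_card padic_seq \<Rightarrow> 'p padic_seq"
  is "\<lambda>X. if padic_null CARD('p) X then (\<lambda>_. 0) else (\<lambda>n. inverse (X n))"
  by (auto intro: padic_Cauchy_inverse[OF prime_card])

lift_definition padic_seq_norm :: "'p::prime_card padic_seq \<Rightarrow> real"
  is "\<lambda>X. lim (\<lambda>n. rat_pnorm CARD('p) (X n))" .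

lift_definition padic_seq_const :: "rat \<Rightarrow> 'p::prime_card padic_seq" is "\<lambda>x _. x" by simp

lemma equivp_padic_seq_rel: "equivp (padic_seq_rel :: 'p::prime_card padic_seq \<Rightarrow> _)"
proof (rule equivpI)
  show "reflp (padic_seq_rel :: 'p padic_seq \<Rightarrow> _)"
    by (rule reflpI, transfer) simp
  show "symp (padic_seq_rel :: 'p padic_seq \<Rightarrow> _)"
    by (rule sympI, transfer) (use padic_null_minus[OF prime_card] in fastforce)
  show "transp (padic_seq_rel :: 'p padic_seq \<Rightarrow> _)"
    by (rule transpI, transfer) (use padic_null_add[OF prime_card] in fastforce)
qed


lemma padic_seq_rel_add:
  "padic_seq_rel a b \<Longrightarrow> padic_seq_rel c d \<Longrightarrow> padic_seq_rel (a + c) (b + d)"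
  by transfer (use padic_null_add[OF prime_card] in \<open>fastforce simp: add_diff_add\<close>)

lemma padic_seq_rel_minus: "padic_seq_rel a b \<Longrightarrow> padic_seq_rel (- a) (- b)"
  by transfer (use padic_null_minus[OF prime_card] in fastforce)

lemma padic_seq_rel_mult_left:
  assumes "padic_seq_rel a b" shows "padic_seq_rel (c * a) (c * b)"
  using assms
  by transfer (use padic_null_mult[OF prime_card] in \<open>fastforce simp: right_diff_distrib\<close>)

lemmas padic_seq_rel_refl = equivp_reflp[OF equivp_padic_seq_rel]
lemmas padic_seq_rel_sym = equivp_symp[OF equivp_padic_seq_rel]
lemmas padic_seq_rel_trans = equivp_transp[OF equivp_padic_seq_rel]

lemma padic_seq_rel_mult:
  assumes "padic_seq_rel a b" "padic_seq_rel c d"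
  shows "padic_seq_rel (a * c) (b * d)"
  using padic_seq_rel_trans[OF padic_seq_rel_mult_left[OF assms(2), of a]
      padic_seq_rel_mult_left[OF assms(1), of d, unfolded mult.commute[of d]]]
  by simp

lemma padic_seq_inverse_left:
  "\<not> padic_seq_rel x 0 \<Longrightarrow> padic_seq_rel (padic_seq_inverse x * x) 1"
  by transfer (auto intro: padic_null_mult_inverse[OF prime_card])

lemma padic_seq_inverse_0: "padic_seq_rel x 0 \<Longrightarrow> padic_seq_inverse x = 0"
  by transfer auto

lemma padic_seq_rel_inverse:
  assumes xy: "padic_seq_rel x y"
  shows "padic_seq_rel (padic_seq_inverse x) (padic_seq_inverse y)"
proof (cases "padic_seq_rel x 0")
  case True
  then have "padic_seq_rel y 0"
    using xy by (blast intro: padic_seq_rel_trans padic_seq_rel_sym)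
  then show ?thesis using True by (simp add: padic_seq_inverse_0 padic_seq_rel_refl)
next
  case False
  then have ny: "\<not> padic_seq_rel y 0"
    using xy by (blast intro: padic_seq_rel_trans padic_seq_rel_sym)
  let ?i = "padic_seq_inverse x" and ?j = "padic_seq_inverse y"
  have "padic_seq_rel (?i * 1) (?i * (?j * y))"
    by (intro padic_seq_rel_mult_left padic_seq_rel_sym[OF padic_seq_inverse_left[OF ny]])
  moreover have "padic_seq_rel (?i * (?j * y)) (?i * (?j * x))"
    by (intro padic_seq_rel_mult_left padic_seq_rel_sym[OF xy])
  moreover have "padic_seq_rel (?j * (?i * x)) (?j * 1)"
    by (intro padic_seq_rel_mult_left padic_seq_inverse_left[OF False])
  then have "padic_seq_rel (?i * (?j * x)) (?j * 1)" by (simp add: mult.left_commute)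
  ultimately have "padic_seq_rel (?i * 1) (?j * 1)"
    by (blast intro: padic_seq_rel_trans)
  then show ?thesis by simp
qed

lemma padic_seq_rel_norm:
  "padic_seq_rel x y \<Longrightarrow> padic_seq_norm x = padic_seq_norm y"
  by transfer (rule padic_norm_lim_eq[OF prime_card])

lemma padic_seq_rel_0_1: "\<not> padic_seq_rel (0 :: 'p::prime_card padic_seq) 1"
  by transfer (simp add: padic_null_def rat_pnorm_minus[OF prime_card] LIMSEQ_const_iff)

quotient_type 'p padic = "'p::prime_card padic_seq" / padic_seq_rel
  by (rule equivp_padic_seq_rel)

instantiation padic :: (prime_card) field
begin
lift_definition zero_padic :: "'a padic" is 0 .
lift_definition one_padic :: "'a padic" is 1 .
lift_definition plus_padic :: "'a padic \<Rightarrow> 'a padic \<Rightarrow> 'a padic" is "(+)"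
  by (rule padic_seq_rel_add)
lift_definition times_padic :: "'a padic \<Rightarrow> 'a padic \<Rightarrow> 'a padic" is "(*)"
  by (rule padic_seq_rel_mult)
lift_definition uminus_padic :: "'a padic \<Rightarrow> 'a padic" is uminus
  by (rule padic_seq_rel_minus)
lift_definition inverse_padic :: "'a padic \<Rightarrow> 'a padic" is padic_seq_inverse
  by (rule padic_seq_rel_inverse)
definition minus_padic :: "'a padic \<Rightarrow> 'a padic \<Rightarrow> 'a padic"
  where "minus_padic x y = x + - y"
definition divide_padic :: "'a padic \<Rightarrow> 'a padic \<Rightarrow> 'a padic"
  where "divide_padic x y = x * inverse y"
instance
proof
  fix a b c :: "'a padic"
  show "a * b * c = a * (b * c)"
    by transfer (simp add: mult.assoc padic_seq_rel_refl)
  show "a * b = b * a"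
    by transfer (simp add: mult.commute padic_seq_rel_refl)
  show "1 * a = a"
    by transfer (simp add: padic_seq_rel_refl)
  show "a + b + c = a + (b + c)"
    by transfer (simp add: add.assoc padic_seq_rel_refl)
  show "a + b = b + a"
    by transfer (simp add: add.commute padic_seq_rel_refl)
  show "0 + a = a"
    by transfer (simp add: padic_seq_rel_refl)
  show "- a + a = 0"
    by transfer (simp add: padic_seq_rel_refl)
  show "(a + b) * c = a * c + b * c"
    by transfer (simp add: distrib_right padic_seq_rel_refl)
  show "(0 :: 'a padic) \<noteq> 1"
    by transfer (rule padic_seq_rel_0_1)
  show "inverse a * a = 1" if "a \<noteq> 0"
    using that by transfer (rule padic_seq_inverse_left)
  show "inverse (0 :: 'a padic) = 0"
    by transfer (simp add: padic_seq_inverse_0 padic_seq_rel_refl)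
qed (simp_all add: minus_padic_def divide_padic_def)
end

lift_definition padic_norm :: "'p::prime_card padic \<Rightarrow> real" is padic_seq_norm
  by (rule padic_seq_rel_norm)

lift_definition padic_of_rat :: "rat \<Rightarrow> 'p::prime_card padic" is padic_seq_const .

lemma padic_of_rat_add: "padic_of_rat (x + y) = padic_of_rat x + padic_of_rat y"
  by (transfer, transfer) simp

lemma padic_of_rat_mult: "padic_of_rat (x * y) = padic_of_rat x * padic_of_rat y"
  by (transfer, transfer) simp

lemma padic_of_rat_0: "padic_of_rat 0 = 0"
  by (transfer, transfer) simp

lemma padic_of_rat_1: "padic_of_rat 1 = 1"
  by (transfer, transfer) simp

lemma padic_norm_padic_of_rat:
  "padic_norm (padic_of_rat x :: 'p::prime_card padic) = rat_pnorm CARD('p) x"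
  by (transfer, transfer) simp

lemma padic_of_rat_eq_0: "padic_of_rat x = (0 :: 'p::prime_card padic) \<longleftrightarrow> x = 0"
  by (transfer, transfer) (simp add: padic_null_def LIMSEQ_const_iff rat_pnorm_eq_0_iff[OF prime_card])

lemma padic_of_nat: "padic_of_rat (of_nat n) = of_nat n"
  by (induction n) (simp_all add: padic_of_rat_0 padic_of_rat_1 padic_of_rat_add)

instance padic :: (prime_card) field_char_0
proof
  have inj: "m = n" if "of_nat m = (of_nat n :: 'a padic)" "m \<le> n" for m n
  proof -
    have "of_nat (n - m) = (0 :: 'a padic)" using that by (simp add: of_nat_diff)
    then have "padic_of_rat (of_nat (n - m)) = (0 :: 'a padic)" by (simp only: padic_of_nat)
    then show ?thesis using that by (simp add: padic_of_rat_eq_0 del: of_nat_diff)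
  qed
  show "inj (of_nat :: nat \<Rightarrow> 'a padic)"
    by (rule injI) (metis inj nle_le)
qed

lemma of_rat_eq_padic_of_rat: "of_rat x = (padic_of_rat x :: 'p::prime_card padic)"
proof -
  have neg: "padic_of_rat (- y) = - (padic_of_rat y :: 'p padic)" for y
    using padic_of_rat_add[of "-y" y] by (simp add: padic_of_rat_0 eq_neg_iff_add_eq_0)
  have int: "padic_of_rat (of_int i) = (of_int i :: 'p padic)" for i
    by (cases i rule: int_diff_cases)
      (simp add: padic_of_rat_add[of _ "- _", simplified] neg padic_of_nat)
  obtain a b where x: "x = of_int a / of_int b" "b \<noteq> 0" by (rule rat_as_quotient)
  have "padic_of_rat x * of_int b = (of_int a :: 'p padic)"
    using x by (simp flip: int padic_of_rat_mult)
  then have "padic_of_rat x = (of_int a / of_int b :: 'p padic)" using x(2) by (simp add: eq_divide_eq)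
  then show ?thesis by (simp only: x(1) of_rat_divide of_rat_of_int_eq)
qed

lemma padic_norm_of_rat: "padic_norm (of_rat x :: 'p::prime_card padic) = rat_pnorm CARD('p) x"
  by (simp add: of_rat_eq_padic_of_rat padic_norm_padic_of_rat)

lemma padic_seq_norm_tendsto:
  "(\<lambda>n. rat_pnorm CARD('p) (Rep_padic_seq X n)) \<longlonglongrightarrow> padic_seq_norm (X :: 'p::prime_card padic_seq)"
  by transfer (use padic_Cauchy_norm_convergent[OF prime_card] in \<open>auto simp: convergent_LIMSEQ_iff\<close>)

lemma padic_norm_mult: "padic_norm (x * y) = padic_norm x * padic_norm (y :: 'p::prime_card padic)"
proof transfer
  fix x y :: "'p padic_seq"
  have "(\<lambda>n. rat_pnorm CARD('p) (Rep_padic_seq (x * y) n)) \<longlonglongrightarrow> padic_seq_norm x * padic_seq_norm y"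
    using tendsto_mult[OF padic_seq_norm_tendsto[of x] padic_seq_norm_tendsto[of y]]
    by (simp add: times_padic_seq.rep_eq rat_pnorm_mult[OF prime_card])
  then show "padic_seq_norm (x * y) = padic_seq_norm x * padic_seq_norm y"
    using LIMSEQ_unique padic_seq_norm_tendsto by blast
qed

lemma padic_norm_add:
  "padic_norm (x + y) \<le> max (padic_norm x) (padic_norm (y :: 'p::prime_card padic))"
proof transfer
  fix x y :: "'p padic_seq"
  show "padic_seq_norm (x + y) \<le> max (padic_seq_norm x) (padic_seq_norm y)"
    by (rule LIMSEQ_le[OF padic_seq_norm_tendsto[of "x + y"]
          tendsto_max[OF padic_seq_norm_tendsto[of x] padic_seq_norm_tendsto[of y]]])
      (auto simp: plus_padic_seq.rep_eq intro!: rat_pnorm_add[OF prime_card])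
qed

lemma padic_norm_nonneg [simp]: "padic_norm x \<ge> 0"
  by transfer (rule LIMSEQ_le_const[OF padic_seq_norm_tendsto], auto)

lemma padic_norm_eq_0_iff [simp]: "padic_norm x = 0 \<longleftrightarrow> x = 0"
proof transfer
  fix x :: "'a padic_seq"
  have "padic_seq_rel x 0 \<longleftrightarrow> (\<lambda>n. rat_pnorm CARD('a) (Rep_padic_seq x n)) \<longlonglongrightarrow> 0"
    by transfer (simp add: padic_null_def)
  then show "padic_seq_norm x = 0 \<longleftrightarrow> padic_seq_rel x 0"
    using padic_seq_norm_tendsto[of x] LIMSEQ_unique by auto
qed

lemma padic_rat_dense:
  assumes "e > 0"
  obtains q where "padic_norm (x - of_rat q) < e"
proof -
  have "\<exists>q. padic_norm (x - padic_of_rat q) < e"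
    unfolding minus_padic_def
  proof (transfer fixing: e)
    fix x :: "'a padic_seq"
    obtain N where N: "\<forall>m\<ge>N. \<forall>n\<ge>N. rat_pnorm CARD('a) (Rep_padic_seq x m - Rep_padic_seq x n) < e / 2"
      using Rep_padic_seq[of x] half_gt_zero[OF assms]
      unfolding padic_Cauchy_def mem_Collect_eq by blast
    let ?y = "x + - padic_seq_const (Rep_padic_seq x N)"
    have "Rep_padic_seq ?y n = Rep_padic_seq x n - Rep_padic_seq x N" for n
      by (simp only: plus_padic_seq.rep_eq uminus_padic_seq.rep_eq padic_seq_const.rep_eq)
    then have "\<exists>M. \<forall>n\<ge>M. rat_pnorm CARD('a) (Rep_padic_seq ?y n) \<le> e / 2"
      using N by (simp only:) (blast intro: less_imp_le)
    then have "padic_seq_norm ?y \<le> e / 2"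
      by (rule LIMSEQ_le_const2[OF padic_seq_norm_tendsto[of ?y]])
    then show "\<exists>q. padic_seq_norm (x + - padic_seq_const q) < e"
      using assms by (intro exI[of _ "Rep_padic_seq x N"]) linarith
  qed
  then show ?thesis using that by (auto simp: of_rat_eq_padic_of_rat)
qed

lemma padic_norm_minus [simp]: "padic_norm (- x) = padic_norm x"
proof -
  have "padic_norm (- 1 :: 'a padic) = 1"
    using padic_norm_of_rat[of "- 1", where 'p = 'a] rat_pnorm_minus[OF prime_card, of 1, where 'a1 = 'a]
    by simp
  then show ?thesis using padic_norm_mult[of "- 1" x] by simp
qed

lemma padic_norm_diff: "padic_norm (x - y) \<le> max (padic_norm x) (padic_norm y)"
  using padic_norm_add[of x "- y"] by simp

text \<open>
  By convention \<open>v\<^sub>p(0) = \<infinity>\<close>; otherwise the valuation is determined by \<open>|x|\<^sub>p = p powi (- v\<^sub>p(x))\<close>.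
\<close>

definition padic_val :: "'p::prime_card padic \<Rightarrow> ereal" where
  "padic_val x = (if x = 0 then \<infinity> else ereal (- log (real CARD('p)) (padic_norm x)))"


section \<open>Digit expansions\<close>

text \<open>
  \<open>padic_digit_expansion x a\<close> says that \<open>x\<close> is the \<open>p\<close>-adic limit of the partial sums of
  \<open>a\<^sub>n p\<^sup>n\<close>, \<open>n \<ge> -r\<close>, with all \<open>a\<^sub>n\<close> in the balanced digit range and \<open>a\<^sub>n = 0\<close> for \<open>n < -r\<close>.
\<close>

definition padic_digit_expansion :: "'p::prime_card padic \<Rightarrow> (int \<Rightarrow> int) \<Rightarrow> bool" where
  "padic_digit_expansion x a \<longleftrightarrow>
     (\<forall>n. a n \<in> {- ((int CARD('p) - 1) div 2) .. (int CARD('p) - 1) div 2}) \<and>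
     (\<exists>r. (\<forall>n < - r. a n = 0) \<and>
        (\<lambda>N. padic_norm (x - of_rat (\<Sum>n = - r..int N. of_int (a n) * of_nat CARD('p) powi n)))
          \<longlonglongrightarrow> 0)"

lemma rat_pnorm_prime: "prime p \<Longrightarrow> rat_pnorm p (of_nat p) = 1 / real p"
  using rat_pval_divide[of p "int p" 1]
  by (auto simp: rat_pnorm_def power_int_minus_divide)

lemma rat_pnorm_powi:
  assumes p: "prime p"
  shows "rat_pnorm p (of_nat p powi n) = real p powi (- n)"
proof -
  have pow: "rat_pnorm p (of_nat p ^ m) = 1 / real p ^ m" for m
    by (induction m) (simp_all add: rat_pnorm_mult[OF p] rat_pnorm_prime[OF p])
  show ?thesis
  proof (cases "n \<ge> 0")
    case True
    then have "rat_pnorm p (of_nat p powi n) = rat_pnorm p (of_nat p ^ nat n)"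
      by (simp add: power_int_def)
    then show ?thesis using True by (simp add: pow power_int_def divide_inverse power_inverse)
  next
    case False
    then have "rat_pnorm p (of_nat p powi n) = rat_pnorm p (inverse (of_nat p ^ nat (- n)))"
      by (simp add: power_int_def power_inverse)
    then show ?thesis using False
      by (simp only: pow rat_pnorm_inverse[OF p]) (simp add: power_int_def)
  qed
qed

lemma rat_pnorm_of_int_le_1: "prime p \<Longrightarrow> rat_pnorm p (of_int k) \<le> 1"
  using rat_pval_divide[of p k 1] prime_ge_1_nat[of p] power_int_mono_iff
  by (cases "k = 0") (auto simp: rat_pnorm_def power_int_minus inverse_le_1_iff one_le_power)

lemma rat_pnorm_of_int_eq_1:
  assumes "prime p" "\<not> int p dvd k" shows "rat_pnorm p (of_int k) = 1"
proof -
  have "k \<noteq> 0" using assms by auto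
  then show ?thesis
    using rat_pval_divide[of p k 1] assms by (simp add: rat_pnorm_def not_dvd_imp_multiplicity_0)
qed

lemma rat_pnorm_of_int_dvd:
  assumes p: "prime p" and "int p dvd k" shows "rat_pnorm p (of_int k) \<le> 1 / real p"
proof -
  obtain j where "k = int p * j" using assms by blast
  then have "rat_pnorm p (of_int k) = 1 / real p * rat_pnorm p (of_int j)"
    by (simp add: rat_pnorm_mult[OF p] rat_pnorm_prime[OF p])
  also have "\<dots> \<le> 1 / real p * 1"
    by (intro mult_left_mono rat_pnorm_of_int_le_1 p) auto
  finally show ?thesis by simp
qed

lemma rat_pnorm_sum_le:
  assumes p: "prime p" and "B \<ge> 0" and "\<And>n. n \<in> A \<Longrightarrow> rat_pnorm p (f n) \<le> B"
  shows "rat_pnorm p (\<Sum>n\<in>A. f n) \<le> B"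
proof (cases "finite A")
  case True
  then show ?thesis using assms(3)
  proof (induction A)
    case (insert x F)
    then have "max (rat_pnorm p (f x)) (rat_pnorm p (sum f F)) \<le> B" by simp
    then have "rat_pnorm p (f x + sum f F) \<le> B"
      by (rule order_trans[OF rat_pnorm_add[OF p]])
    then show ?case using insert.hyps by simp
  qed (use assms in simp)
qed (use assms in simp)

lemma padic_digit_expansion_unique:
  fixes x :: "'p::prime_card padic"
  assumes a: "padic_digit_expansion x a" and b: "padic_digit_expansion x b"
  shows "a = b"
proof (rule ccontr)
  assume "a \<noteq> b"
  let ?p = "CARD('p)"
  have p: "prime ?p" by (rule prime_card)
  have p1: "real ?p > 1" using prime_gt_1_nat[OF p] by simp
  define S where "S = (\<lambda>a r N. \<Sum>n = - r..int N. of_int (a n) * of_nat ?p powi n :: rat)"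
  obtain r where r: "\<forall>n < - r. a n = 0" and la: "(\<lambda>N. padic_norm (x - of_rat (S a r N))) \<longlonglongrightarrow> 0"
    using a unfolding padic_digit_expansion_def S_def by blast
  obtain s where s: "\<forall>n < - s. b n = 0" and lb: "(\<lambda>N. padic_norm (x - of_rat (S b s N))) \<longlonglongrightarrow> 0"
    using b unfolding padic_digit_expansion_def S_def by blast
  define m where "m = max r s"
  obtain n0 where "a n0 \<noteq> b n0" using \<open>a \<noteq> b\<close> by blast
  then have ex: "\<exists>i. a (- m + int i) \<noteq> b (- m + int i)"
    using r s by (intro exI[of _ "nat (n0 + m)"]) (smt (verit, best) m_def int_nat_eq)
  define k where "k = - m + int (LEAST i. a (- m + int i) \<noteq> b (- m + int i))"
  have k: "a k \<noteq> b k" unfolding k_def by (rule LeastI_ex[OF ex])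
  have km: "k \<ge> - m" by (simp add: k_def)
  have below: "a n = b n" if "n < k" for n
  proof (cases "n < - m")
    case True
    then show ?thesis using r s by (simp add: m_def)
  next
    case False
    then show ?thesis
      using that not_less_Least[of "nat (n + m)" "\<lambda>i. a (- m + int i) \<noteq> b (- m + int i)"]
      by (simp add: k_def)
  qed
  have ra: "a n \<in> {- ((int ?p - 1) div 2) .. (int ?p - 1) div 2}"
    and rb: "b n \<in> {- ((int ?p - 1) div 2) .. (int ?p - 1) div 2}" for n
    using a b unfolding padic_digit_expansion_def by blast+
  have "\<bar>a k - b k\<bar> < int ?p" using ra[of k] rb[of k] p1 by auto
  then have "\<not> int ?p dvd a k - b k" using k zdvd_imp_le[of "int ?p" "\<bar>a k - b k\<bar>"] by auto
  then have n1: "rat_pnorm ?p (of_int (a k - b k)) = 1" by (rule rat_pnorm_of_int_eq_1[OF p])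
  have big: "rat_pnorm ?p (S a r N - S b s N) \<ge> real ?p powi (- k)" if N: "int N \<ge> k" for N
  proof -
    define f where "f = (\<lambda>n. of_int (a n - b n) * of_nat ?p powi n :: rat)"
    have Sa: "S a r N = (\<Sum>n = - m..int N. of_int (a n) * of_nat ?p powi n)"
      unfolding S_def by (rule sum.mono_neutral_left) (use r in \<open>auto simp: m_def\<close>)
    have Sb: "S b s N = (\<Sum>n = - m..int N. of_int (b n) * of_nat ?p powi n)"
      unfolding S_def by (rule sum.mono_neutral_left) (use s in \<open>auto simp: m_def\<close>)
    have "S a r N - S b s N = (\<Sum>n = - m..int N. f n)"
      unfolding Sa Sb f_def by (simp add: sum_subtractf left_diff_distrib)
    also have "\<dots> = (\<Sum>n = k..int N. f n)"
      by (rule sum.mono_neutral_right) (use below km in \<open>auto simp: f_def\<close>)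
    also have "\<dots> = f k + (\<Sum>n = k + 1..int N. f n)"
      using N by (simp add: sum.remove[of "{k..int N}" k] atLeastAtMost_insertL
          flip: simp_from_to) (rule sum.cong, auto)
    finally have eq: "S a r N - S b s N = f k + (\<Sum>n = k + 1..int N. f n)" .
    have fk: "rat_pnorm ?p (f k) = real ?p powi (- k)"
      unfolding f_def rat_pnorm_mult[OF p] n1 rat_pnorm_powi[OF p] by simp
    have "rat_pnorm ?p (\<Sum>n = k + 1..int N. f n) \<le> real ?p powi (- (k + 1))"
    proof (rule rat_pnorm_sum_le[OF p])
      fix n assume n: "n \<in> {k + 1..int N}"
      have "rat_pnorm ?p (f n) \<le> 1 * real ?p powi (- n)"
        unfolding f_def rat_pnorm_mult[OF p] rat_pnorm_powi[OF p]
        by (intro mult_right_mono rat_pnorm_of_int_le_1 p) auto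
      also have "\<dots> \<le> real ?p powi (- (k + 1))"
        using n p1 by (simp add: power_int_increasing)
      finally show "rat_pnorm ?p (f n) \<le> real ?p powi (- (k + 1))" .
    qed simp
    also have "\<dots> < real ?p powi (- k)"
      using p1 by (intro power_int_strict_increasing) auto
    finally have "rat_pnorm ?p (\<Sum>n = k + 1..int N. f n) < rat_pnorm ?p (f k)" by (simp add: fk)
    moreover have "rat_pnorm ?p (f k) \<le>
        max (rat_pnorm ?p (S a r N - S b s N)) (rat_pnorm ?p (\<Sum>n = k + 1..int N. f n))"
      using rat_pnorm_diff[OF p, of "S a r N - S b s N" "\<Sum>n = k + 1..int N. f n"] unfolding eq by simp
    ultimately show ?thesis using fk by (simp add: le_max_iff_disj)
  qed
  have "(\<lambda>N. max (padic_norm (x - of_rat (S b s N))) (padic_norm (x - of_rat (S a r N)))) \<longlonglongrightarrow> 0"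
    using tendsto_max[OF lb la] by simp
  moreover have "real ?p powi (- k) > 0" using p1 by simp
  ultimately have "\<forall>\<^sub>F N in sequentially.
      max (padic_norm (x - of_rat (S b s N))) (padic_norm (x - of_rat (S a r N))) < real ?p powi (- k)"
    by (rule order_tendstoD(2))
  then obtain N0 where N0: "\<And>N. N \<ge> N0 \<Longrightarrow>
      max (padic_norm (x - of_rat (S b s N))) (padic_norm (x - of_rat (S a r N))) < real ?p powi (- k)"
    unfolding eventually_sequentially by blast
  define N where "N = max N0 (nat k)"
  have "rat_pnorm ?p (S a r N - S b s N) = padic_norm (of_rat (S a r N) - of_rat (S b s N) :: 'p padic)"
    by (simp add: of_rat_diff flip: padic_norm_of_rat)
  also have "\<dots> = padic_norm ((x - of_rat (S b s N)) - (x - of_rat (S a r N)))"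
    by simp
  also have "\<dots> \<le> max (padic_norm (x - of_rat (S b s N))) (padic_norm (x - of_rat (S a r N)))"
    by (rule padic_norm_diff)
  also have "\<dots> < real ?p powi (- k)" by (rule N0) (simp add: N_def)
  finally have "rat_pnorm ?p (S a r N - S b s N) < real ?p powi (- k)" .
  moreover have "k \<le> int N" unfolding N_def by linarith
  ultimately show False using big[of N] by linarith
qed

lemma padic_digit_exists:
  fixes x :: "'p::prime_card padic"
  assumes odd: "odd CARD('p)" and x: "padic_norm x \<le> 1"
  shows "\<exists>c \<in> {- ((int CARD('p) - 1) div 2) .. (int CARD('p) - 1) div 2}.
    padic_norm (x - of_int c) \<le> 1 / real CARD('p)"
proof -
  let ?p = "CARD('p)"
  have p: "prime ?p" by (rule prime_card)
  have p1: "real ?p > 1" using prime_gt_1_nat[OF p] by simp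
  obtain q where q: "padic_norm (x - of_rat q) < 1 / real ?p"
    using padic_rat_dense[of "1 / real ?p" x] p1 by auto
  have "padic_norm (of_rat q :: 'p padic) \<le> max (padic_norm x) (padic_norm (x - of_rat q))"
    using padic_norm_diff[of x "x - of_rat q"] by simp
  also have "\<dots> \<le> 1"
  proof -
    have "1 / real ?p < 1" using p1 by simp
    then show ?thesis using x q by linarith
  qed
  finally have q1: "rat_pnorm ?p q \<le> 1" by (simp add: padic_norm_of_rat)
  obtain a b where ab: "quotient_of q = (a, b)" by force
  have b: "b > 0" and cop: "coprime a b" and qab: "q = of_int a / of_int b"
    using quotient_of_denom_pos[OF ab] quotient_of_coprime[OF ab] quotient_of_div[OF ab] by auto
  have nb: "\<not> int ?p dvd b"
  proof
    assume d: "int ?p dvd b"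
    then have "\<not> int ?p dvd a" using cop p by (meson coprime_common_divisor not_prime_unit prime_int_nat_transfer prime_nat_int_transfer prime_card_int)
    then have "rat_pnorm ?p (of_int a) = 1" by (rule rat_pnorm_of_int_eq_1[OF p])
    moreover have "of_int a = q * of_int b" using qab b by simp
    ultimately have "1 = rat_pnorm ?p q * rat_pnorm ?p (of_int b)"
      by (simp add: rat_pnorm_mult[OF p])
    also have "\<dots> \<le> 1 * (1 / real ?p)"
      by (intro mult_mono q1 rat_pnorm_of_int_dvd[OF p d]) auto
    finally show False using p1 by (simp add: field_simps)
  qed
  then have "coprime b (int ?p)"
    using prime_imp_coprime[OF prime_card_int[where 'a = 'p]] by (simp add: coprime_commute)
  then obtain b' where b': "[b * b' = 1] (mod int ?p)" using cong_solve_coprime_int by blast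
  define H where "H = (int ?p - 1) div 2"
  have H: "int ?p = 2 * H + 1" using odd unfolding H_def by (auto elim!: oddE)
  have H0: "H \<ge> 0" using p1 H by linarith
  define c where "c = (a * b' + H) mod int ?p - H"
  have "(a * b' + H) mod int ?p \<ge> 0" "(a * b' + H) mod int ?p < int ?p"
    using p1 by (auto intro!: pos_mod_sign pos_mod_bound)
  then have c: "c \<in> {- H..H}" using H by (auto simp: c_def)
  have "int ?p dvd (a * b' + H) - (a * b' + H) mod int ?p"
    by (simp add: minus_mod_eq_mult_div)
  then have d1: "int ?p dvd a * b' - c" by (simp add: c_def algebra_simps)
  have d2: "int ?p dvd b * b' - 1" using b' by (simp add: cong_iff_dvd_diff)
  have "a - b * c = b * (a * b' - c) - a * (b * b' - 1)" by (simp add: algebra_simps)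
  then have d3: "int ?p dvd a - b * c" using d1 d2 by (metis dvd_diff dvd_mult)
  have "q - of_int c = of_int (a - b * c) / of_int b" using qab b by (simp add: field_simps)
  then have "rat_pnorm ?p (q - of_int c) =
      rat_pnorm ?p (of_int (a - b * c)) * inverse (rat_pnorm ?p (of_int b))"
    by (simp only: divide_inverse rat_pnorm_mult[OF p] rat_pnorm_inverse[OF p])
  also have "\<dots> = rat_pnorm ?p (of_int (a - b * c))"
    using rat_pnorm_of_int_eq_1[OF p nb] by simp
  also have "\<dots> \<le> 1 / real ?p" by (rule rat_pnorm_of_int_dvd[OF p d3])
  finally have "padic_norm (of_rat (q - of_int c) :: 'p padic) \<le> 1 / real ?p"
    by (simp only: padic_norm_of_rat)
  then have "padic_norm (of_rat q - of_int c :: 'p padic) \<le> 1 / real ?p"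
    by (simp add: of_rat_diff)
  then have "padic_norm (x - of_int c) \<le> 1 / real ?p"
    using padic_norm_add[of "x - of_rat q" "of_rat q - of_int c"] q by simp
  then show ?thesis using c unfolding H_def by blast
qed

lemma of_rat_powi: "of_rat (x powi n) = (of_rat x powi n :: 'p::prime_card padic)"
  by (simp add: power_int_def of_rat_power of_rat_inverse)

lemma padic_digit_expansion_exists:
  fixes x :: "'p::prime_card padic"
  assumes odd: "odd CARD('p)"
  shows "\<exists>a. padic_digit_expansion x a"
proof -
  let ?p = "CARD('p)"
  have p: "prime ?p" by (rule prime_card)
  have p1: "real ?p > 1" using prime_gt_1_nat[OF p] by simp
  have pnz: "(of_nat ?p :: 'p padic) \<noteq> 0" using p1 by simp
  define D where "D = {- ((int ?p - 1) div 2) .. (int ?p - 1) div 2}"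
  have npow: "padic_norm (of_nat ?p powi n :: 'p padic) = real ?p powi (- n)" for n
    using padic_norm_of_rat[of "of_nat ?p powi n", where 'p = 'p] rat_pnorm_powi[OF p]
    by (simp add: of_rat_powi)
  have ninv: "padic_norm (inverse (of_nat ?p) :: 'p padic) = real ?p"
    using npow[of "- 1"] by simp
  have "\<forall>y::'p padic. \<exists>c. padic_norm y \<le> 1 \<longrightarrow> c \<in> D \<and> padic_norm (y - of_int c) \<le> 1 / real ?p"
    using padic_digit_exists[OF odd] unfolding D_def by blast
  then obtain d :: "'p padic \<Rightarrow> int" where
    d: "\<And>y. padic_norm y \<le> 1 \<Longrightarrow> d y \<in> D \<and> padic_norm (y - of_int (d y)) \<le> 1 / real ?p"
    by metis
  obtain r :: nat where r: "padic_norm x < real ?p ^ r"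
    using real_arch_pow[OF p1] by blast
  define y where "y = rec_nat (x * of_nat ?p powi (int r)) (\<lambda>_ z. (z - of_int (d z)) * inverse (of_nat ?p))"
  have y0: "y 0 = x * of_nat ?p powi (int r)"
    and ySuc: "y (Suc j) = (y j - of_int (d (y j))) * inverse (of_nat ?p)" for j
    by (simp_all add: y_def)
  have y1: "padic_norm (y j) \<le> 1" for j
  proof (induction j)
    case 0
    show ?case using r p1 unfolding y0 padic_norm_mult npow
      by (simp add: power_int_minus field_simps)
  next
    case (Suc j)
    show ?case using d[OF Suc] p1 unfolding ySuc padic_norm_mult ninv by (simp add: field_simps)
  qed
  define a where "a = (\<lambda>n. if n < - int r then 0 else d (y (nat (n + int r))))"
  have part: "x - of_rat (\<Sum>n\<in>{- int r..<- int r + int j}. of_int (a n) * of_nat ?p powi n) =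
      of_nat ?p powi (int j - int r) * y j" for j
  proof (induction j)
    case 0
    show ?case using pnz by (simp add: y0 power_int_minus)
  next
    case (Suc j)
    have set: "{- int r..<- int r + int (Suc j)} = insert (int j - int r) {- int r..<- int r + int j}"
      by auto
    have aj: "a (int j - int r) = d (y j)" by (simp add: a_def)
    have "x - of_rat (\<Sum>n\<in>{- int r..<- int r + int (Suc j)}. of_int (a n) * of_nat ?p powi n) =
        of_nat ?p powi (int j - int r) * (y j - of_int (d (y j)))"
      unfolding set using Suc
      by (simp add: aj of_rat_add of_rat_mult of_rat_powi algebra_simps)
    also have "\<dots> = of_nat ?p powi (int (Suc j) - int r) * y (Suc j)"
    proof -
      have "of_nat ?p powi (int (Suc j) - int r) = of_nat ?p powi (int j - int r) * (of_nat ?p :: 'p padic)"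
        using pnz power_int_add_1[of "of_nat ?p :: 'p padic" "int j - int r"] by (simp add: algebra_simps)
      then show ?thesis using pnz by (simp add: ySuc)
    qed
    finally show ?case .
  qed
  have bound: "padic_norm (x - of_rat (\<Sum>n = - int r..int N. of_int (a n) * of_nat ?p powi n)) \<le> (1 / real ?p) ^ N" for N
  proof -
    have "{- int r..int N} = {- int r..<- int r + int (N + r + 1)}" by auto
    then have "padic_norm (x - of_rat (\<Sum>n = - int r..int N. of_int (a n) * of_nat ?p powi n)) =
        real ?p powi (- (int N + 1)) * padic_norm (y (N + r + 1))"
      using part[of "N + r + 1"] by (simp only: padic_norm_mult npow) (simp add: algebra_simps)
    also have "\<dots> \<le> real ?p powi (- int N) * 1"
      using p1 by (intro mult_mono y1 power_int_increasing) auto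
    also have "\<dots> = (1 / real ?p) ^ N" by (simp add: power_int_minus divide_inverse power_inverse)
    finally show ?thesis .
  qed
  have "(\<lambda>N. padic_norm (x - of_rat (\<Sum>n = - int r..int N. of_int (a n) * of_nat ?p powi n))) \<longlonglongrightarrow> 0"
    by (rule tendsto_sandwich[of "\<lambda>_. 0" _ _ "\<lambda>N. (1 / real ?p) ^ N"])
      (use bound p1 in \<open>auto intro!: LIMSEQ_power_zero\<close>)
  moreover have "a n \<in> D" for n
    using d y1 p1 by (auto simp: a_def D_def)
  moreover have "\<forall>n < - int r. a n = 0" by (simp add: a_def)
  ultimately show ?thesis unfolding padic_digit_expansion_def D_def by blast
qed

definition padic_digits :: "'p::prime_card padic \<Rightarrow> int \<Rightarrow> int" where
  "padic_digits x = (THE a. padic_digit_expansion x a)"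

lemma padic_digits_eq: "padic_digit_expansion x a \<Longrightarrow> padic_digits x = a"
  unfolding padic_digits_def by (blast intro: padic_digit_expansion_unique)

lemma padic_digits_expansion:
  fixes x :: "'p::prime_card padic"
  assumes "odd CARD('p)"
  shows "padic_digit_expansion x (padic_digits x)"
  using padic_digit_expansion_exists[OF assms] padic_digits_eq by metis

text \<open>
  Only finitely many digits of nonpositive index are nonzero, so summing over these gives
  the finite sums \<open>a\<^sub>n p\<^sup>n\<close> over \<open>-r \<le> n \<le> 0\<close> and \<open>-r \<le> n \<le> -1\<close>, independently of \<open>r\<close>.
\<close>

definition browkin_s :: "'p::prime_card padic \<Rightarrow> rat" where
  "browkin_s x = (\<Sum>n | n \<le> 0 \<and> padic_digits x n \<noteq> 0.
     of_int (padic_digits x n) * of_nat CARD('p) powi n)"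

definition browkin_t :: "'p::prime_card padic \<Rightarrow> rat" where
  "browkin_t x = (\<Sum>n | n \<le> -1 \<and> padic_digits x n \<noteq> 0.
     of_int (padic_digits x n) * of_nat CARD('p) powi n)"


section \<open>The algorithm Browkin II\<close>

definition browkin2_quotient :: "nat \<Rightarrow> 'p::prime_card padic \<Rightarrow> rat" where
  "browkin2_quotient n x =
     (if even n then browkin_s x
      else if padic_val (x - of_rat (browkin_t x)) = 0 then browkin_t x
      else browkin_t x - sgn (browkin_t x))"

text \<open>
  The algorithm stops at the first \<open>n\<close> with \<open>\<alpha>\<^sub>n = b\<^sub>n\<close>. The sequences below are continued beyond
  that point with junk values, so they are meaningful as a whole only
  under \<open>browkin2_infinite\<close>.
\<close>

primrec browkin2_complete :: "'p::prime_card padic \<Rightarrow> nat \<Rightarrow> 'p padic" where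
  "browkin2_complete \<alpha> 0 = \<alpha>"
| "browkin2_complete \<alpha> (Suc n) =
     1 / (browkin2_complete \<alpha> n - of_rat (browkin2_quotient n (browkin2_complete \<alpha> n)))"

definition browkin2 :: "'p::prime_card padic \<Rightarrow> nat \<Rightarrow> rat" where
  "browkin2 \<alpha> n = browkin2_quotient n (browkin2_complete \<alpha> n)"

definition browkin2_infinite :: "'p::prime_card padic \<Rightarrow> bool" where
  "browkin2_infinite \<alpha> \<longleftrightarrow> (\<forall>n. browkin2_complete \<alpha> n \<noteq> of_rat (browkin2 \<alpha> n))"

definition periodic_from :: "(nat \<Rightarrow> 'a) \<Rightarrow> nat \<Rightarrow> bool" where
  "periodic_from b h \<longleftrightarrow> (\<exists>k\<ge>1. \<forall>n\<ge>h. b (n + k) = b n)"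

definition browkin2_periodic :: "'p::prime_card padic \<Rightarrow> bool" where
  "browkin2_periodic \<alpha> \<longleftrightarrow> browkin2_infinite \<alpha> \<and> (\<exists>h. periodic_from (browkin2 \<alpha>) h)"

definition preperiod_length :: "(nat \<Rightarrow> 'a) \<Rightarrow> nat" where
  "preperiod_length b = (LEAST h. periodic_from b h)"

text \<open>
  In characteristic 0 an irreducible quadratic has distinct roots,
  so the other root is a root different from \<open>\<alpha>\<close>.
\<close>

definition quadratic_conjugate :: "'p::prime_card padic \<Rightarrow> 'p padic \<Rightarrow> bool" where
  "quadratic_conjugate \<alpha> \<beta> \<longleftrightarrow>
     (\<exists>f :: rat poly. irreducible f \<and> degree f = 2 \<and>
        poly (map_poly of_rat f) \<alpha> = 0 \<and> poly (map_poly of_rat f) \<beta> = 0 \<and> \<beta> \<noteq> \<alpha>)"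

end

theory Submission
  imports Defs "HOL-Computational_Algebra.Field_as_Ring"
begin

text \<open>
  Write \<open>x\<^sub>n\<close> for the complete quotients of \<open>\<alpha>\<close>, \<open>y\<^sub>n\<close> for their conjugates and \<open>b\<^sub>n\<close> for the
  partial quotients. The algorithm is built so that \<open>|b\<^sub>n| = |x\<^sub>n|\<close> is \<open>1\<close> for even \<open>n\<close> and larger
  than \<open>1\<close> for odd \<open>n\<close> (\<open>browkin2_norm_eq_1_iff\<close>; the case \<open>n = 0\<close> is where \<open>|\<alpha>| = 1\<close> enters).
  So the norms of the partial quotients reveal the parity of their index, and every period is
  even. The same norms drive the conjugates: from \<open>|y\<^sub>0| < 1\<close> the recursion
  \<open>y\<^bsub>n+1\<^esub> = 1 / (y\<^sub>n - b\<^sub>n)\<close> gives \<open>|y\<^sub>n| < 1\<close> for even \<open>n\<close> and \<open>|y\<^sub>n| = 1\<close> for odd \<open>n\<close>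
  (\<open>complete_quotients_conjugate_norm\<close>).

  Suppose the preperiod had odd length \<open>m + 1\<close>, and let \<open>k\<close> be a period. Partial quotients that
  agree from some index on determine the complete quotient there
  (\<open>browkin2_complete_periodic\<close>), so \<open>x\<^bsub>m+1+k\<^esub> = x\<^bsub>m+1\<^esub>\<close>, and conjugating gives
  \<open>y\<^bsub>m+1+k\<^esub> = y\<^bsub>m+1\<^esub>\<close> (\<open>complete_quotients_conjugate_eq\<close>). Undoing one step of the recursion,
  \<open>b\<^bsub>m+k\<^esub> - b\<^sub>m = y\<^bsub>m+k\<^esub> - y\<^sub>m\<close>, which has norm less than \<open>1\<close> because \<open>m\<close> and \<open>m + k\<close> are even.
  At even indices the partial quotient is a value of the floor function \<open>s\<close>, and two such
  values that are congruent modulo \<open>p\<close> coincide (\<open>browkin_s_cong\<close>). Hence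
  \<open>b\<^bsub>m+k\<^esub> = b\<^sub>m\<close>, so the expansion is already periodic from index \<open>m\<close>, a contradiction.
\<close>

section \<open>The ultrametric inequality\<close>

lemma prime_card_gt_Suc_0 [simp]: "Suc 0 < CARD('p::prime_card)"
  using prime_gt_1_nat[OF prime_card[where 'a = 'p]] by simp

lemma prime_card_gt_1: "1 < real CARD('p::prime_card)"
  by simp

lemma padic_norm_1 [simp]: "padic_norm (1 :: 'p::prime_card padic) = 1"
  using padic_norm_of_rat[of 1, where 'p = 'p] by simp

lemma padic_norm_0 [simp]: "padic_norm (0 :: 'p::prime_card padic) = 0"
  by (simp only: padic_norm_eq_0_iff)

lemma padic_norm_inverse:
  "padic_norm (1 / x) = 1 / padic_norm (x :: 'p::prime_card padic)"
proof (cases "x = 0")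
  case False
  then have "padic_norm (1 / x) * padic_norm x = 1"
    by (simp flip: padic_norm_mult)
  then show ?thesis
    using False by (simp add: eq_divide_eq)
qed simp

lemma padic_norm_diff_commute:
  "padic_norm (x - y) = padic_norm (y - x :: 'p::prime_card padic)"
  using padic_norm_minus[of "x - y"] by simp

lemma padic_norm_diff_triangle:
  "padic_norm (x - z) \<le> max (padic_norm (x - y)) (padic_norm (y - z :: 'p::prime_card padic))"
  using padic_norm_add[of "x - y" "y - z"] by simp

lemma padic_norm_diff_eq_left:
  fixes x y :: "'p::prime_card padic"
  assumes "padic_norm y < padic_norm x"
  shows "padic_norm (x - y) = padic_norm x"
  using padic_norm_diff[of x y] padic_norm_add[of "x - y" y] assms by simp

lemma padic_norm_diff_eq_right:
  fixes x y :: "'p::prime_card padic"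
  assumes "padic_norm x < padic_norm y"
  shows "padic_norm (x - y) = padic_norm y"
  using padic_norm_diff_eq_left[OF assms] padic_norm_diff_commute[of x y] by simp

lemma padic_norm_eq_if_close:
  fixes x y :: "'p::prime_card padic"
  assumes "padic_norm (x - y) < padic_norm x"
  shows "padic_norm y = padic_norm x"
  using padic_norm_diff_eq_left[OF assms] by simp


section \<open>Truncated digit expansions\<close>

text \<open>The two floor functions of the algorithm are truncations of the digit expansion at different
  places, so a single error estimate serves both.\<close>

definition padic_truncation :: "int \<Rightarrow> 'p::prime_card padic \<Rightarrow> rat" where
  "padic_truncation m x = (\<Sum>n | n \<le> m \<and> padic_digits x n \<noteq> 0.
     of_int (padic_digits x n) * of_nat CARD('p) powi n)"

lemma browkin_s_truncation: "browkin_s = padic_truncation 0"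
  and browkin_t_truncation: "browkin_t = padic_truncation (- 1)"
  by (simp_all add: fun_eq_iff browkin_s_def browkin_t_def padic_truncation_def)

lemma padic_truncation_eq_sum:
  fixes x :: "'p::prime_card padic"
  assumes "\<forall>n < - r. padic_digits x n = 0"
  shows "padic_truncation m x = (\<Sum>n = - r..m. of_int (padic_digits x n) * of_nat CARD('p) powi n)"
  unfolding padic_truncation_def
  by (rule sum.mono_neutral_left) (use assms in \<open>auto simp: not_le[symmetric]\<close>)

text \<open>Every omitted term has index at least \<open>m + 1\<close>, so the ultrametric inequality bounds the finite
  partial sums of the tail; a far enough partial sum is within the bound of \<open>x\<close> itself.\<close>

lemma padic_norm_truncation_error:
  fixes x :: "'p::prime_card padic"
  assumes odd: "odd CARD('p)"
  shows "padic_norm (x - of_rat (padic_truncation m x)) \<le> real CARD('p) powi (- (m + 1))"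
proof -
  let ?p = "CARD('p)"
  let ?f = "\<lambda>n. of_int (padic_digits x n) * of_nat ?p powi n :: rat"
  have p: "prime ?p" by (rule prime_card)
  obtain r where r: "\<forall>n < - r. padic_digits x n = 0"
    and lim: "(\<lambda>N. padic_norm (x - of_rat (\<Sum>n = - r..int N. ?f n))) \<longlonglongrightarrow> 0"
    using padic_digits_expansion[OF odd, of x] unfolding padic_digit_expansion_def by blast
  have pos: "real ?p powi (- (m + 1)) > 0" by (simp add: zero_less_power_int)
  obtain N0 where N0: "\<And>N. N \<ge> N0 \<Longrightarrow>
      padic_norm (x - of_rat (\<Sum>n = - r..int N. ?f n)) < real ?p powi (- (m + 1))"
    using order_tendstoD(2)[OF lim pos] unfolding eventually_sequentially by blast
  (* N is beyond m, so that all of the truncation is contained in the partial sum up to N. *)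
  define N where "N = max N0 (nat m)"
  define tail where "tail = (\<Sum>n\<in>{max (- r) (m + 1)..int N}. ?f n)"
  have "{- r..int N} = {- r..m} \<union> {max (- r) (m + 1)..int N}"
    and "{- r..m} \<inter> {max (- r) (m + 1)..int N} = {}"
    by (auto simp: N_def)
  then have split: "(\<Sum>n = - r..int N. ?f n) = padic_truncation m x + tail"
    unfolding tail_def padic_truncation_eq_sum[OF r] by (simp add: sum.union_disjoint)
  have "rat_pnorm ?p tail \<le> real ?p powi (- (m + 1))"
    unfolding tail_def
  proof (rule rat_pnorm_sum_le[OF p])
    fix n assume n: "n \<in> {max (- r) (m + 1)..int N}"
    have "rat_pnorm ?p (?f n) \<le> 1 * real ?p powi (- n)"
      unfolding rat_pnorm_mult[OF p] rat_pnorm_powi[OF p]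
      by (intro mult_right_mono rat_pnorm_of_int_le_1 p) auto
    also have "\<dots> \<le> real ?p powi (- (m + 1))"
      using n less_imp_le[OF prime_card_gt_1[where 'p = 'p]]
      by (simp add: power_int_increasing)
    finally show "rat_pnorm ?p (?f n) \<le> real ?p powi (- (m + 1))" .
  qed (use pos in simp)
  then have "padic_norm (of_rat tail :: 'p padic) \<le> real ?p powi (- (m + 1))"
    by (simp add: padic_norm_of_rat)
  moreover have "padic_norm (x - of_rat (padic_truncation m x + tail)) < real ?p powi (- (m + 1))"
    using N0[of N] unfolding split by (simp add: N_def)
  moreover have "x - of_rat (padic_truncation m x) =
      (x - of_rat (padic_truncation m x + tail)) + of_rat tail"
    by (simp add: of_rat_add)
  then have "padic_norm (x - of_rat (padic_truncation m x)) \<le>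
      max (padic_norm (x - of_rat (padic_truncation m x + tail))) (padic_norm (of_rat tail :: 'p padic))"
    by (simp only: padic_norm_add)
  ultimately show ?thesis by linarith
qed

lemma padic_norm_diff_browkin_s:
  fixes x :: "'p::prime_card padic"
  assumes "odd CARD('p)"
  shows "padic_norm (x - of_rat (browkin_s x)) \<le> 1 / real CARD('p)"
  using padic_norm_truncation_error[OF assms, of x 0]
  by (simp add: browkin_s_truncation power_int_minus inverse_eq_divide)

lemma padic_norm_diff_browkin_t:
  fixes x :: "'p::prime_card padic"
  assumes "odd CARD('p)"
  shows "padic_norm (x - of_rat (browkin_t x)) \<le> 1"
  using padic_norm_truncation_error[OF assms, of x "- 1"] by (simp add: browkin_t_truncation)

lemma power_dvd_if_rat_pnorm_less:
  assumes p: "prime p" and less: "rat_pnorm p (of_int k) < real p powi (- int r)"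
  shows "int p ^ Suc r dvd k"
proof (cases "k = 0")
  case False
  have p1: "1 < real p" using prime_gt_1_nat[OF p] by simp
  have "rat_pval p (of_int k) = int (multiplicity (int p) k)"
    using rat_pval_divide[OF p False, of 1] by simp
  then have "real p powi (- int (multiplicity (int p) k)) < real p powi (- int r)"
    using less False by (simp add: rat_pnorm_def)
  then have "r < multiplicity (int p) k"
    using power_int_increasing[of "- int r" "- int (multiplicity (int p) k)" "real p"] p1
    by (cases "r < multiplicity (int p) k") auto
  then show ?thesis by (intro multiplicity_dvd') simp
qed simp

text \<open>The bound \<open>p - 1\<close> is the one that differences of two balanced digits satisfy.\<close>

lemma abs_digit_sum_less:
  fixes c :: "nat \<Rightarrow> int"
  assumes p: "0 < p" and c: "\<And>j. j \<le> r \<Longrightarrow> \<bar>c j\<bar> \<le> p - 1"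
  shows "\<bar>\<Sum>j\<le>r. c j * p ^ j\<bar> < p ^ Suc r"
proof -
  have "\<bar>\<Sum>j\<le>r. c j * p ^ j\<bar> \<le> (\<Sum>j\<le>r. (p - 1) * p ^ j)"
    using p c by (intro order_trans[OF sum_abs] sum_mono) (auto simp: abs_mult intro!: mult_right_mono)
  also have "\<dots> = p ^ Suc r - 1"
    by (induction r) (simp_all add: algebra_simps)
  finally show ?thesis by simp
qed

text \<open>The value \<open>s(x)\<close> depends only on \<open>x\<close> modulo the maximal ideal. The reason is a clash of
  the two absolute values: scaled by \<open>p\<^sup>r\<close>, the difference \<open>s(x) - s(y)\<close> is an integer divisible
  by \<open>p\<^bsup>r+1\<^esup>\<close> but smaller than \<open>p\<^bsup>r+1\<^esup>\<close> in size.\<close>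

lemma browkin_s_cong:
  fixes x y :: "'p::prime_card padic"
  assumes odd: "odd CARD('p)" and xy: "padic_norm (x - y) < 1"
  shows "browkin_s x = browkin_s y"
proof -
  let ?p = "CARD('p)"
  have p: "prime ?p" by (rule prime_card)
  have p1: "1 < real ?p" by simp
  note expansions = padic_digits_expansion[OF odd, of x] padic_digits_expansion[OF odd, of y]
  have range: "padic_digits x n \<in> {- ((int ?p - 1) div 2) .. (int ?p - 1) div 2}"
    "padic_digits y n \<in> {- ((int ?p - 1) div 2) .. (int ?p - 1) div 2}" for n
    using expansions unfolding padic_digit_expansion_def by blast+
  obtain a b where "\<forall>n < - a. padic_digits x n = 0" "\<forall>n < - b. padic_digits y n = 0"
    using expansions unfolding padic_digit_expansion_def by blast
  then obtain r :: nat where r: "\<forall>n < - int r. padic_digits x n = 0" "\<forall>n < - int r. padic_digits y n = 0"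
    by (intro that[of "nat (max a b)"]) auto
  define c where "c = (\<lambda>j. padic_digits x (int j - int r) - padic_digits y (int j - int r))"
  define M where "M = (\<Sum>j\<le>r. c j * int ?p ^ j)"
  have "browkin_s x - browkin_s y =
      (\<Sum>n = - int r..0. of_int (padic_digits x n - padic_digits y n) * of_nat ?p powi n)"
    unfolding browkin_s_truncation padic_truncation_eq_sum[OF r(1)] padic_truncation_eq_sum[OF r(2)]
    by (simp add: sum_subtractf left_diff_distrib)
  also have "\<dots> = (\<Sum>j\<le>r. of_int (c j) * of_nat ?p powi (int j - int r))"
    by (rule sum.reindex_bij_witness[of _ "\<lambda>j. int j - int r" "\<lambda>n. nat (n + int r)"])
      (auto simp: c_def)
  also have "\<dots> = of_int M * of_nat ?p powi (- int r)"
    using p1 by (simp add: M_def sum_distrib_right power_int_diff power_int_minus divide_inverse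
        mult.assoc)
  finally have diff: "browkin_s x - browkin_s y = of_int M * of_nat ?p powi (- int r)" .
  have "padic_norm (of_rat (browkin_s x - browkin_s y) :: 'p padic) < 1"
  proof -
    have "1 / real ?p < 1" by simp
    then have "padic_norm (x - of_rat (browkin_s x)) < 1" "padic_norm (y - of_rat (browkin_s y)) < 1"
      using padic_norm_diff_browkin_s[OF odd] le_less_trans by blast+
    then show ?thesis
      using xy padic_norm_diff_triangle[of "of_rat (browkin_s x)" "of_rat (browkin_s y)" x]
        padic_norm_diff_triangle[of x "of_rat (browkin_s y)" y]
      by (simp add: of_rat_diff padic_norm_diff_commute[of "of_rat (browkin_s x)"])
  qed
  then have "rat_pnorm ?p (of_int M) * real ?p powi int r < 1"
    unfolding padic_norm_of_rat diff by (simp add: rat_pnorm_mult[OF p] rat_pnorm_powi[OF p])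
  then have "rat_pnorm ?p (of_int M) < real ?p powi (- int r)"
    using p1 by (simp add: power_int_minus field_simps)
  then have "int ?p ^ Suc r dvd M" by (rule power_dvd_if_rat_pnorm_less[OF p])
  moreover have "\<bar>c j\<bar> \<le> int ?p - 1" for j
    using range(1)[of "int j - int r"] range(2)[of "int j - int r"] odd by (auto simp: c_def)
  then have "\<bar>M\<bar> < int ?p ^ Suc r"
    unfolding M_def using p1 by (intro abs_digit_sum_less) auto
  ultimately have "M = 0" using dvd_imp_le_int by force
  then show ?thesis using diff by simp
qed


section \<open>Norms along the algorithm\<close>

lemma padic_val_eq_0_iff:
  fixes x :: "'p::prime_card padic"
  shows "padic_val x = 0 \<longleftrightarrow> padic_norm x = 1"
proof (cases "x = 0")
  case False
  then have "0 < padic_norm x" by (simp add: less_le)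
  then show ?thesis using False
    using prime_card_gt_Suc_0[where 'p = 'p]
    by (auto simp: padic_val_def zero_ereal_def log_def simp del: prime_card_gt_Suc_0)
qed (auto simp: padic_val_def)

lemma padic_norm_sgn:
  "t \<noteq> 0 \<Longrightarrow> padic_norm (of_rat (sgn t) :: 'p::prime_card padic) = 1"
  by (cases t "0 :: rat" rule: linorder_cases) auto

lemma padic_norm_diff_quotient_even:
  fixes x :: "'p::prime_card padic"
  assumes "odd CARD('p)" "even n"
  shows "padic_norm (x - of_rat (browkin2_quotient n x)) \<le> 1 / real CARD('p)"
  using padic_norm_diff_browkin_s assms by (simp add: browkin2_quotient_def)

text \<open>At odd steps the sign correction is what keeps \<open>x - b\<close> a unit: it is applied exactly when
  \<open>x - t(x)\<close> is not one, and \<open>|x| > 1\<close> makes \<open>t(x)\<close> nonzero, so that the sign is a unit.\<close>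

lemma padic_norm_diff_quotient_odd:
  fixes x :: "'p::prime_card padic"
  assumes odd: "odd CARD('p)" "odd n" and x: "1 < padic_norm x"
  shows "padic_norm (x - of_rat (browkin2_quotient n x)) = 1"
proof (cases "padic_norm (x - of_rat (browkin_t x)) = 1")
  case True
  then show ?thesis using odd by (simp add: browkin2_quotient_def padic_val_eq_0_iff)
next
  case False
  then have lt: "padic_norm (x - of_rat (browkin_t x)) < 1"
    using padic_norm_diff_browkin_t[OF odd(1), of x] by simp
  then have "browkin_t x \<noteq> 0" using x by auto
  then have 1: "padic_norm (- of_rat (sgn (browkin_t x)) :: 'p padic) = 1"
    using padic_norm_sgn by simp
  have "x - of_rat (browkin2_quotient n x) =
      (x - of_rat (browkin_t x)) - (- of_rat (sgn (browkin_t x)))"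
    using False odd by (simp add: browkin2_quotient_def padic_val_eq_0_iff of_rat_diff)
  then show ?thesis using padic_norm_diff_eq_right lt 1 by metis
qed

lemma browkin2_complete_Suc:
  "browkin2_complete \<alpha> (Suc n) = 1 / (browkin2_complete \<alpha> n - of_rat (browkin2 \<alpha> n))"
  by (simp add: browkin2_def)

declare browkin2_complete.simps(2) [simp del]

lemma browkin2_complete_norm_odd:
  fixes \<alpha> :: "'p::prime_card padic"
  assumes odd: "odd CARD('p)" and inf: "browkin2_infinite \<alpha>" and n: "odd n"
  shows "real CARD('p) \<le> padic_norm (browkin2_complete \<alpha> n)"
proof -
  from n obtain m where m: "n = Suc m" "even m" by (cases n) auto
  let ?d = "browkin2_complete \<alpha> m - of_rat (browkin2 \<alpha> m)"
  have "padic_norm ?d \<le> 1 / real CARD('p)"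
    unfolding browkin2_def by (rule padic_norm_diff_quotient_even[OF odd m(2)])
  moreover have "?d \<noteq> 0" using inf by (simp add: browkin2_infinite_def)
  then have "0 < padic_norm ?d" by (simp add: less_le)
  ultimately show ?thesis
    unfolding m(1) browkin2_complete_Suc padic_norm_inverse
    using prime_card_gt_1[where 'p = 'p] by (simp add: field_simps)
qed

text \<open>The index \<open>0\<close> is excluded because \<open>x\<^sub>0 = \<alpha>\<close> is arbitrary; the later complete quotients are
  reciprocals of the differences just estimated.\<close>

lemma browkin2_complete_norm_even:
  fixes \<alpha> :: "'p::prime_card padic"
  assumes odd: "odd CARD('p)" and inf: "browkin2_infinite \<alpha>" and n: "even n" "0 < n"
  shows "padic_norm (browkin2_complete \<alpha> n) = 1"
proof -
  from n obtain m where m: "n = Suc m" "odd m" by (cases n) auto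
  have "1 < padic_norm (browkin2_complete \<alpha> m)"
    using browkin2_complete_norm_odd[OF odd inf m(2)] prime_card_gt_1[where 'p = 'p] by linarith
  from padic_norm_diff_quotient_odd[OF odd m(2) this] show ?thesis
    unfolding m(1) browkin2_complete_Suc padic_norm_inverse browkin2_def by simp
qed

lemma browkin2_norm:
  fixes \<alpha> :: "'p::prime_card padic"
  assumes odd: "odd CARD('p)" and inf: "browkin2_infinite \<alpha>" and \<alpha>: "padic_norm \<alpha> = 1"
  shows "padic_norm (of_rat (browkin2 \<alpha> n) :: 'p padic) = padic_norm (browkin2_complete \<alpha> n)"
proof (rule padic_norm_eq_if_close)
  show "padic_norm (browkin2_complete \<alpha> n - of_rat (browkin2 \<alpha> n)) < padic_norm (browkin2_complete \<alpha> n)"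
  proof (cases "even n")
    case True
    have "padic_norm (browkin2_complete \<alpha> n) = 1"
      using browkin2_complete_norm_even[OF odd inf True] \<alpha> by (cases "n = 0") auto
    moreover have "1 / real CARD('p) < 1" by simp
    ultimately show ?thesis
      using padic_norm_diff_quotient_even[OF odd True, of "browkin2_complete \<alpha> n"]
      unfolding browkin2_def by linarith
  next
    case False
    then have "1 < padic_norm (browkin2_complete \<alpha> n)"
      using browkin2_complete_norm_odd[OF odd inf False] prime_card_gt_1[where 'p = 'p] by linarith
    then show ?thesis
      using padic_norm_diff_quotient_odd[OF odd False] unfolding browkin2_def by simp
  qed
qed

lemma browkin2_norm_eq_1_iff:
  fixes \<alpha> :: "'p::prime_card padic"
  assumes odd: "odd CARD('p)" and inf: "browkin2_infinite \<alpha>" and \<alpha>: "padic_norm \<alpha> = 1"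
  shows "padic_norm (of_rat (browkin2 \<alpha> n) :: 'p padic) = 1 \<longleftrightarrow> even n"
    and "odd n \<Longrightarrow> 1 < padic_norm (of_rat (browkin2 \<alpha> n) :: 'p padic)"
proof -
  show gt: "1 < padic_norm (of_rat (browkin2 \<alpha> n) :: 'p padic)" if "odd n"
    unfolding browkin2_norm[OF assms]
    using browkin2_complete_norm_odd[OF odd inf that] prime_card_gt_1[where 'p = 'p] by linarith
  show "padic_norm (of_rat (browkin2 \<alpha> n) :: 'p padic) = 1 \<longleftrightarrow> even n"
    using gt browkin2_complete_norm_even[OF odd inf, of n] \<alpha>
    by (cases "even n"; cases "n = 0") (auto simp: browkin2_norm[OF assms])
qed


section \<open>Periodic quotients force periodic complete quotients\<close>

text \<open>Passing from two complete quotients back to their predecessors with the same partial quotient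
  divides their distance by the product of their norms, since
  \<open>1 / u - 1 / v = (v - u) / (u v)\<close>. These norms are \<open>1\<close> and at least \<open>p\<close> alternately, so two
  steps shrink the distance by a factor \<open>p\<^sup>2\<close> or more, while all distances stay bounded by \<open>1\<close>;
  hence they vanish. For this the two sequences must be in step, which is why the shift has to be
  even.\<close>

lemma browkin2_complete_periodic:
  fixes \<alpha> :: "'p::prime_card padic"
  assumes odd: "odd CARD('p)" and inf: "browkin2_infinite \<alpha>"
    and k: "even k" and per: "\<forall>n\<ge>h. browkin2 \<alpha> (n + k) = browkin2 \<alpha> n"
    and n: "h \<le> n"
  shows "browkin2_complete \<alpha> (n + k) = browkin2_complete \<alpha> n"
proof -
  let ?p = "real CARD('p)"
  let ?x = "browkin2_complete \<alpha>"
  have p1: "1 < ?p" by simp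
  define d where "d = (\<lambda>n. padic_norm (?x n - ?x (n + k)))"
  have nz: "?x (Suc m) \<noteq> 0" for m
    using inf unfolding browkin2_complete_Suc browkin2_infinite_def by simp
  have step: "d m = d (Suc m) / (padic_norm (?x (Suc m)) * padic_norm (?x (Suc m + k)))"
    if "h \<le> m" for m
  proof -
    have tail: "?x j = 1 / ?x (Suc j) + of_rat (browkin2 \<alpha> j)" for j
      by (simp add: browkin2_complete_Suc)
    have "?x m - ?x (m + k) = 1 / ?x (Suc m) - 1 / ?x (Suc m + k)"
      by (subst tail[of m], subst tail[of "m + k"]) (use per that in simp)
    also have "\<dots> = (?x (Suc m + k) - ?x (Suc m)) * (1 / (?x (Suc m) * ?x (Suc m + k)))"
      using nz[of m] nz[of "m + k"] by (simp add: field_simps)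
    finally show ?thesis
      unfolding d_def
      by (simp only: padic_norm_mult padic_norm_inverse padic_norm_diff_commute[of "?x (Suc m + k)"]) simp
  qed
  have step_odd: "d m = d (Suc m)" if "h \<le> m" "odd m" for m
    using step[OF that(1)] that(2) k browkin2_complete_norm_even[OF odd inf, of "Suc m"]
      browkin2_complete_norm_even[OF odd inf, of "Suc m + k"] by simp
  have step_even: "d m \<le> d (Suc m) / ?p\<^sup>2" if "h \<le> m" "even m" for m
  proof -
    have "?p * ?p \<le> padic_norm (?x (Suc m)) * padic_norm (?x (Suc m + k))"
      using that(2) k by (intro mult_mono browkin2_complete_norm_odd[OF odd inf]) auto
    then show ?thesis
      unfolding step[OF that(1)] power2_eq_square using p1
      by (intro divide_left_mono) (simp_all add: d_def nz less_le)
  qed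
  have even_le_1: "d m \<le> 1" if "h \<le> m" "even m" for m
  proof -
    have close: "padic_norm (?x j - of_rat (browkin2 \<alpha> j)) \<le> 1" if "even j" for j
      using padic_norm_diff_quotient_even[OF odd that, of "?x j"] p1
      unfolding browkin2_def by (auto elim!: order_trans)
    show ?thesis
      using padic_norm_diff_triangle[of "?x m" "?x (m + k)" "of_rat (browkin2 \<alpha> m)"]
        close[of m] close[of "m + k"] that k per
      by (simp add: d_def padic_norm_diff_commute[of "of_rat (browkin2 \<alpha> m)"])
  qed
  have le_1: "d m \<le> 1" if "h \<le> m" for m
    using even_le_1[of m] even_le_1[of "Suc m"] step_odd[of m] that by (cases "even m") auto
  have two_steps: "d m \<le> d (Suc (Suc m)) / ?p\<^sup>2" if "h \<le> m" for m
    using step_even[of m] step_even[of "Suc m"] step_odd[of m] step_odd[of "Suc m"] that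
    by (cases "even m") auto
  have bound: "\<forall>m\<ge>h. d m \<le> (1 / ?p\<^sup>2) ^ j" for j
  proof (induction j)
    case (Suc j)
    show ?case
    proof (intro allI impI)
      fix m assume m: "h \<le> m"
      have "d m \<le> d (Suc (Suc m)) / ?p\<^sup>2" by (rule two_steps[OF m])
      also have "\<dots> \<le> (1 / ?p\<^sup>2) ^ j / ?p\<^sup>2"
        using Suc m by (intro divide_right_mono) auto
      finally show "d m \<le> (1 / ?p\<^sup>2) ^ Suc j" by simp
    qed
  qed (use le_1 in simp)
  have "(\<lambda>j. (1 / ?p\<^sup>2) ^ j) \<longlonglongrightarrow> 0"
    using p1 one_less_power[OF p1, of 2] by (intro LIMSEQ_realpow_zero) auto
  then have "d n \<le> 0"
    by (rule LIMSEQ_le_const) (use bound n in blast)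
  then have "d n = 0" unfolding d_def by (rule order_antisym) simp
  then show ?thesis by (simp add: d_def)
qed


section \<open>Conjugation\<close>

lemma
  fixes x :: "'a::field_char_0"
  shows poly_of_rat_add:
      "poly (map_poly of_rat (g + h)) x = poly (map_poly of_rat g) x + poly (map_poly of_rat h) x"
    and poly_of_rat_diff:
      "poly (map_poly of_rat (g - h)) x = poly (map_poly of_rat g) x - poly (map_poly of_rat h) x"
    and poly_of_rat_mult:
      "poly (map_poly of_rat (g * h)) x = poly (map_poly of_rat g) x * poly (map_poly of_rat h) x"
proof -
  interpret map_poly_comm_ring_hom "of_rat :: rat \<Rightarrow> 'a" ..
  show "poly (map_poly of_rat (g + h)) x = poly (map_poly of_rat g) x + poly (map_poly of_rat h) x"
    "poly (map_poly of_rat (g - h)) x = poly (map_poly of_rat g) x - poly (map_poly of_rat h) x"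
    "poly (map_poly of_rat (g * h)) x = poly (map_poly of_rat g) x * poly (map_poly of_rat h) x"
    by (simp_all add: hom_distribs)
qed

text \<open>The conjugate of \<open>\<alpha>\<close> is run through the continued fraction of \<open>\<alpha>\<close>, not through its own, so
  the partial quotients are a parameter here.\<close>

primrec complete_quotients :: "(nat \<Rightarrow> rat) \<Rightarrow> 'a::field_char_0 \<Rightarrow> nat \<Rightarrow> 'a" where
  "complete_quotients b x 0 = x"
| "complete_quotients b x (Suc n) = 1 / (complete_quotients b x n - of_rat (b n))"

lemma complete_quotients_browkin2:
  "complete_quotients (browkin2 \<alpha>) \<alpha> n = browkin2_complete \<alpha> n"
  by (induction n) (simp_all add: browkin2_complete_Suc)

text \<open>For roots \<open>a\<close>, \<open>a'\<close> of the same irreducible polynomial this relation is the graph of the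
  isomorphism from \<open>\<rat>(a)\<close> to \<open>\<rat>(a')\<close> that sends \<open>a\<close> to \<open>a'\<close>. The relation avoids introducing
  these fields as types, and the facts below say that it respects the operations of the
  continued fraction algorithm and is single-valued.\<close>

definition conjugate_pair :: "'a::field_char_0 \<Rightarrow> 'a \<Rightarrow> 'a \<Rightarrow> 'a \<Rightarrow> bool" where
  "conjugate_pair a a' u u' \<longleftrightarrow>
     (\<exists>g :: rat poly. u = poly (map_poly of_rat g) a \<and> u' = poly (map_poly of_rat g) a')"

lemma conjugate_pair_refl: "conjugate_pair a a' a a'"
  unfolding conjugate_pair_def by (rule exI[of _ "[:0, 1:]"]) simp

lemma conjugate_pair_of_rat: "conjugate_pair a a' (of_rat q) (of_rat q)"
  unfolding conjugate_pair_def by (rule exI[of _ "[:q:]"]) (simp add: of_rat_hom.map_poly_pCons_hom)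

lemma conjugate_pair_diff:
  assumes "conjugate_pair a a' u u'" "conjugate_pair a a' v v'"
  shows "conjugate_pair a a' (u - v) (u' - v')"
proof -
  obtain g g' where
    "u = poly (map_poly of_rat g) a" "u' = poly (map_poly of_rat g) a'"
    "v = poly (map_poly of_rat g') a" "v' = poly (map_poly of_rat g') a'"
    using assms unfolding conjugate_pair_def by blast
  then show ?thesis
    unfolding conjugate_pair_def by (intro exI[of _ "g - g'"]) (simp add: poly_of_rat_diff)
qed

text \<open>A polynomial that does not vanish at one root of \<open>f\<close> is coprime to \<open>f\<close>, and a Bezout
  identity inverts it at all roots with the same cofactor. This uniformity is what makes
  conjugation compatible with inverses, and also single-valued.\<close>

lemma rational_polynomial_inverse_at_roots:
  fixes a :: "'a::field_char_0"
  assumes irred: "irreducible f" and root: "poly (map_poly of_rat f) a = 0"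
    and g: "poly (map_poly of_rat g) a \<noteq> 0"
  obtains w :: "rat poly"
    where "\<And>c :: 'a. poly (map_poly of_rat f) c = 0 \<Longrightarrow>
      poly (map_poly of_rat w) c * poly (map_poly of_rat g) c = 1"
proof -
  have "\<not> f dvd g"
    using g root by (auto elim!: dvdE simp: poly_of_rat_mult)
  then have "coprime f g"
    using irred by (simp add: irreducible_imp_prime_elem prime_elem_imp_coprime)
  then have bezout: "fst (bezout_coefficients f g) * f + snd (bezout_coefficients f g) * g = 1"
    by (simp add: bezout_coefficients_fst_snd)
  show ?thesis
  proof (rule that)
    fix c :: 'a assume c: "poly (map_poly of_rat f) c = 0"
    show "poly (map_poly of_rat (snd (bezout_coefficients f g))) c * poly (map_poly of_rat g) c = 1"
      using arg_cong[OF bezout, of "\<lambda>h. poly (map_poly of_rat h) c"] c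
      by (simp add: poly_of_rat_add poly_of_rat_mult)
  qed
qed

context
  fixes f :: "rat poly" and a a' :: "'a::field_char_0"
  assumes irred: "irreducible f"
    and root: "poly (map_poly of_rat f) a = 0" and root': "poly (map_poly of_rat f) a' = 0"
begin

lemma conjugate_pair_zero:
  assumes "conjugate_pair a a' 0 u'"
  shows "u' = 0"
proof (rule ccontr)
  assume nz: "u' \<noteq> 0"
  obtain g where g: "poly (map_poly of_rat g) a = 0" "u' = poly (map_poly of_rat g) a'"
    using assms unfolding conjugate_pair_def by auto
  then obtain w where "poly (map_poly of_rat w) a * poly (map_poly of_rat g) a = 1"
    using rational_polynomial_inverse_at_roots[OF irred root', of g] nz root by metis
  with g show False by simp
qed

lemma conjugate_pair_inverse:
  assumes "conjugate_pair a a' u u'" "u \<noteq> 0"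
  shows "conjugate_pair a a' (1 / u) (1 / u')"
proof -
  obtain g where g: "u = poly (map_poly of_rat g) a" "u' = poly (map_poly of_rat g) a'"
    using assms unfolding conjugate_pair_def by auto
  then obtain w where w: "\<And>c. poly (map_poly of_rat f) c = 0 \<Longrightarrow>
      poly (map_poly of_rat w) c * poly (map_poly of_rat g) c = (1 :: 'a)"
    using rational_polynomial_inverse_at_roots[OF irred root, of g] assms(2) by metis
  have "1 / u = poly (map_poly of_rat w) a" "1 / u' = poly (map_poly of_rat w) a'"
    using w[OF root] w[OF root'] g by (auto simp: divide_eq_eq)
  then show ?thesis unfolding conjugate_pair_def by blast
qed

lemma conjugate_pair_complete_quotients:
  assumes "\<And>n. complete_quotients b a n \<noteq> of_rat (b n)"
  shows "conjugate_pair a a' (complete_quotients b a n) (complete_quotients b a' n)"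
proof (induction n)
  case (Suc n)
  then show ?case
    using assms[of n]
    by (simp add: conjugate_pair_inverse conjugate_pair_diff conjugate_pair_of_rat)
qed (simp add: conjugate_pair_refl)

lemma complete_quotients_conjugate_eq:
  assumes inf: "\<And>n. complete_quotients b a n \<noteq> of_rat (b n)"
    and eq: "complete_quotients b a m = complete_quotients b a n"
  shows "complete_quotients b a' m = complete_quotients b a' n"
proof -
  have "conjugate_pair a a' 0 (complete_quotients b a' m - complete_quotients b a' n)"
    using conjugate_pair_diff[OF conjugate_pair_complete_quotients[OF inf, of m]
        conjugate_pair_complete_quotients[OF inf, of n]] eq by simp
  then have "complete_quotients b a' m - complete_quotients b a' n = 0"
    by (rule conjugate_pair_zero)
  then show ?thesis by simp
qed

end

text \<open>In every step \<open>b n\<close> dominates the conjugate, which makes the norm of the next one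
  \<open>1 / |b n|\<close>.\<close>

lemma complete_quotients_conjugate_norm:
  fixes \<beta> :: "'p::prime_card padic"
  assumes b: "\<And>n. even n \<Longrightarrow> padic_norm (of_rat (b n) :: 'p padic) = 1"
      "\<And>n. odd n \<Longrightarrow> 1 < padic_norm (of_rat (b n) :: 'p padic)"
    and \<beta>: "padic_norm \<beta> < 1"
  shows "if even n then padic_norm (complete_quotients b \<beta> n) < 1
    else padic_norm (complete_quotients b \<beta> n) = 1"
proof (induction n)
  case (Suc n)
  have less: "padic_norm (complete_quotients b \<beta> n) < padic_norm (of_rat (b n) :: 'p padic)"
    using Suc b[of n] by (cases "even n") auto
  have "padic_norm (complete_quotients b \<beta> (Suc n)) = 1 / padic_norm (of_rat (b n) :: 'p padic)"
    using padic_norm_diff_eq_right[OF less] by (simp add: padic_norm_inverse)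
  then show ?case using b[of n] by (cases "even n") auto
qed (use \<beta> in simp)


section \<open>The parity of the preperiod\<close>

theorem theorem8:
  fixes \<alpha> \<alpha>' :: "'p::prime_card padic"
  assumes "odd CARD('p)"
    and "browkin2_periodic \<alpha>"
    and "quadratic_conjugate \<alpha> \<alpha>'"
    and "padic_norm \<alpha> = 1"
    and "padic_norm \<alpha>' < 1"
  shows "\<not> odd (preperiod_length (browkin2 \<alpha>))"
proof
  let ?b = "browkin2 \<alpha>"
  let ?y = "complete_quotients ?b \<alpha>'"
  assume "odd (preperiod_length ?b)"
  then obtain m where m: "preperiod_length ?b = Suc m" "even m"
    by (cases "preperiod_length ?b") auto
  have inf: "browkin2_infinite \<alpha>" and "\<exists>h. periodic_from ?b h"
    using assms(2) by (auto simp: browkin2_periodic_def)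
  then have "periodic_from ?b (Suc m)"
    unfolding m(1)[symmetric] preperiod_length_def by (blast intro: LeastI_ex)
  then obtain k where k: "1 \<le> k" "\<forall>n\<ge>Suc m. ?b (n + k) = ?b n"
    unfolding periodic_from_def by blast
  note norm_b = browkin2_norm_eq_1_iff[OF assms(1) inf assms(4)]
  have "?b (Suc m + k) = ?b (Suc m)" using k(2) by blast
  then have "even (Suc m + k) \<longleftrightarrow> even (Suc m)"
    using norm_b(1)[of "Suc m + k"] norm_b(1)[of "Suc m"] by metis
  then have even_k: "even k" by presburger
  have x: "complete_quotients ?b \<alpha> n = browkin2_complete \<alpha> n" for n
    by (rule complete_quotients_browkin2)
  obtain f :: "rat poly" where f: "irreducible f"
    "poly (map_poly of_rat f) \<alpha> = 0" "poly (map_poly of_rat f) \<alpha>' = 0"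
    using assms(3) unfolding quadratic_conjugate_def by blast
  have "?y (Suc m + k) = ?y (Suc m)"
  proof (rule complete_quotients_conjugate_eq[OF f])
    show "complete_quotients ?b \<alpha> n \<noteq> of_rat (?b n)" for n
      using inf by (simp add: x browkin2_infinite_def)
    show "complete_quotients ?b \<alpha> (Suc m + k) = complete_quotients ?b \<alpha> (Suc m)"
      unfolding x by (rule browkin2_complete_periodic[OF assms(1) inf even_k k(2)]) simp
  qed
  then have "?y (m + k) - of_rat (?b (m + k)) = ?y m - of_rat (?b m)"
    by simp
  then have diff: "of_rat (?b (m + k)) - of_rat (?b m) = ?y (m + k) - ?y m"
    by (simp add: algebra_simps)
  have "padic_norm (?y n) < 1" if "even n" for n
    using complete_quotients_conjugate_norm[of ?b \<alpha>' n] norm_b assms(5) that by simp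
  then have close: "padic_norm (of_rat (?b (m + k)) - of_rat (?b m) :: 'p padic) < 1"
    unfolding diff using padic_norm_diff[of "?y (m + k)" "?y m"] m(2) even_k
    by (auto intro: le_less_trans)
  have "padic_norm (browkin2_complete \<alpha> n - of_rat (?b n)) < 1" if "even n" for n
    using padic_norm_diff_quotient_even[OF assms(1) that, of "browkin2_complete \<alpha> n"]
      prime_card_gt_1[where 'p = 'p]
    unfolding browkin2_def by (auto elim: le_less_trans)
  (* At even indices complete and partial quotients are congruent, so the congruence of the partial
     quotients passes to the complete quotients, whose values under s then agree. *)
  then have "padic_norm (browkin2_complete \<alpha> (m + k) - of_rat (?b (m + k))) < 1"
    "padic_norm (browkin2_complete \<alpha> m - of_rat (?b m)) < 1"
    using m(2) even_k by simp_all
  then have "padic_norm (browkin2_complete \<alpha> (m + k) - browkin2_complete \<alpha> m) < 1"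
    using close
      padic_norm_diff_triangle[of "browkin2_complete \<alpha> (m + k)" "browkin2_complete \<alpha> m" "of_rat (?b (m + k))"]
      padic_norm_diff_triangle[of "of_rat (?b (m + k))" "browkin2_complete \<alpha> m" "of_rat (?b m)"]
    by (simp add: padic_norm_diff_commute[of "of_rat (?b m)"])
  from browkin_s_cong[OF assms(1) this] have "?b (m + k) = ?b m"
    using m(2) even_k by (simp add: browkin2_def browkin2_quotient_def)
  with k(2) have "\<forall>n\<ge>m. ?b (n + k) = ?b n"
    by (metis le_eq_less_or_eq Suc_leI)
  with k(1) have "periodic_from ?b m" unfolding periodic_from_def by blast
  then have "preperiod_length ?b \<le> m" unfolding preperiod_length_def by (rule Least_le)
  with m(1) show False by simp
qed

end
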